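(* The Lie geometric deformation of a flat front in hyperbolic space yields a $1$-parameter family of flat fronts in hyperbolic space: if $f$ is the Legendre lift of an (umbilic-free) flat front $\mathfrak{f}:M^2\to H^3$ and $\lambda\mapsto f(\lambda)=T(\lambda)f$ is its Lie geometric deformation, then for every real $\lambda\neq\frac12$ the Legendre map $f(\lambda)$ is, for a suitable choice of the constant of integration of $T(\lambda)$ (that is, up to a constant transformation in $O(4,2)$), the Legendre lift of a flat front in $H^3$.
   Context: $\mathbb{R}^{4,2}$ is $\mathbb{R}^6$ with an inner product $(\cdot,\cdot)$ of signature $(4,2)$, $|x|^2:=(x,x)$. Fix an orthogonal decomposition $\mathbb{R}^{4,2}=\mathbb{R}^{1,1}\oplus\mathbb{R}^{3,1}$ and an orthonormal basis $(\mathfrak{p},\mathfrak{q})$ of $\mathbb{R}^{1,1}$ with $|\mathfrak{p}|^2=-1$, $|\mathfrak{q}|^2=1$. Hyperbolic space is $H^3=\{y\in\mathbb{R}^{3,1}:|y|^2=-1,\ y_0>0\}$. A Legendre map is a smooth map $f$ from a surface $M^2$ into the null 2-planes of $\mathbb{R}^{4,2}$ with $(ds,s')=0$ for all sections $s,s'$ of $f$, and regular: at each point, $d_Xs\in f$ for all sections $s$ of $f$ only if $X=0$. Let $\mathfrak{f}:M^2\to H^3$ be a smooth map with unit normal field $\mathfrak{t}:M^2\to S^{2,1}=\{y\in\mathbb{R}^{3,1}:|y|^2=1\}$, $(\mathfrak{t},\mathfrak{f})=0$, $(\mathfrak{t},d\mathfrak{f})=0$. It is a front if its Legendre lift $f:=\mathrm{span}\{\mathfrak{q}+\mathfrak{f},\mathfrak{p}+\mathfrak{t}\}$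 is a (regular) Legendre map. Its parallel fronts are $\cosh t\,\mathfrak{f}+\sinh t\,\mathfrak{t}$, $t\in\mathbb{R}$, with unit normal fields $\sinh t\,\mathfrak{f}+\cosh t\,\mathfrak{t}$. It is flat if it and its parallel fronts have vanishing intrinsic Gauss curvature wherever they immerse. Flat fronts are considered away from umbilics (points where the two curvature spheres of $f$ coincide), and locally, on a simply connected $M^2$ with curvature line coordinates $(u,v)$ so that, with a suitable function $\varphi$, $\cosh\varphi\,\mathfrak{t}_u+\sinh\varphi\,\mathfrak{f}_u=0$ and $\sinh\varphi\,\mathfrak{t}_v+\cosh\varphi\,\mathfrak{f}_v=0$. Lie geometric deformation. The Legendre lift $f$ of a flat front envelops the two isothermic sphere congruences $s^\pm=e^{\pm\varphi}(\mathfrak{p}\pm\mathfrak{q}+\mathfrak{t}\pm\mathfrak{f})$, which satisfy $s^\pm_{uv}\parallel s^\pm$ (Moutard lifts) and $s^\pm=s_1\pm s_2$, where $s_1=\cosh\varphi(\mathfrak{p}+\mathfrak{t})+\sinh\varphi(\mathfrak{q}+\mathfrak{f})$ and $s_2=\sinh\varphi(\mathfrak{p}+\mathfrak{t})+\cosh\varphi(\mathfrak{q}+\mathfrak{f})$ are the curvature spheres. For $a,b\in\mathbb{R}^{4,2}$ let $a\wedge b\in\mathfrak{o}(4,2)$ be $(a\wedge b)c=(a,c)b-(b,c)a$, and let $\star du=du$, $\star dv=-dv$. With $\tau^\pm:=s^\pm\wedge\star ds^\pm$ put $$\tau:=\tau^++\tfrac12d(s^+\wedge s^-)=\tau^-+\tfrac12d(s^-\wedge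 s^+)=-(\mathfrak{p}+\mathfrak{t})\wedge d\mathfrak{t}+(\mathfrak{q}+\mathfrak{f})\wedge d\mathfrak{f}.$$ For $\lambda\in\mathbb{R}$ let $T(\lambda):M^2\to O(4,2)$ be a solution of $dT(\lambda)=T(\lambda)\,\lambda\tau$, unique up to left multiplication by a constant element of $O(4,2)$ (the constant of integration). The Lie geometric deformation of $f$ (of the flat front) is the family $f(\lambda):=T(\lambda)f$ of Legendre maps. *)

theory Defs
  imports "HOL-Analysis.Analysis"
begin

section \<open>Smooth maps and directional derivatives\<close>

abbreviation dirderiv :: "('a::real_normed_vector \<Rightarrow> 'b::real_normed_vector) \<Rightarrow> 'a \<Rightarrow> 'a \<Rightarrow> 'b"
  where "dirderiv g x X \<equiv> frechet_derivative g (at x) X"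

abbreviation pderivative :: "2 \<Rightarrow> (real^2 \<Rightarrow> 'b::real_normed_vector) \<Rightarrow> real^2 \<Rightarrow> 'b"
  where "pderivative i g x \<equiv> dirderiv g x (axis i 1)"

text \<open>For open subsets of a finite-dimensional space.\<close>

primrec cont_diff :: "nat \<Rightarrow> 'a::euclidean_space set \<Rightarrow> ('a \<Rightarrow> 'b::real_normed_vector) \<Rightarrow> bool" where
  "cont_diff 0 U g \<longleftrightarrow> continuous_on U g"
| "cont_diff (Suc k) U g \<longleftrightarrow>
     (\<forall>x\<in>U. g differentiable (at x)) \<and> (\<forall>X. cont_diff k U (\<lambda>x. dirderiv g x X))"

definition smooth_map :: "'a::euclidean_space set \<Rightarrow> ('a \<Rightarrow> 'b::real_normed_vector) \<Rightarrow> bool"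
  where "smooth_map U g \<longleftrightarrow> (\<forall>k. cont_diff k U g)"

section \<open>The pseudo-Euclidean space of signature (4,2)\<close>

definition ip :: "real^6 \<Rightarrow> real^6 \<Rightarrow> real"
  where "ip x y = x$1 * y$1 + x$2 * y$2 + x$3 * y$3 + x$4 * y$4 - x$5 * y$5 - x$6 * y$6"

definition O42 :: "(real^6^6) set"
  where "O42 = {A. \<forall>x y. ip (A *v x) (A *v y) = ip x y}"

definition wedge :: "real^6 \<Rightarrow> real^6 \<Rightarrow> real^6^6"
  where "wedge a b = matrix (\<lambda>c. ip a c *\<^sub>R b - ip b c *\<^sub>R a)"

lemma wedge_mult_vec: "wedge a b *v c = ip a c *\<^sub>R b - ip b c *\<^sub>R a"
proof -
  have "linear (\<lambda>c. ip a c *\<^sub>R b - ip b c *\<^sub>R a)"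
    by (intro linearI) (simp_all add: ip_def algebra_simps)
  then show ?thesis
    by (simp add: wedge_def matrix_works)
qed

text \<open>
  The orthonormal basis \<open>(\<pp>, \<qq>)\<close> of $R^{1,1}$ determines $R^{3,1}$ as its orthogonal complement.
  The vector \<open>\<ee>\<close> is the timelike member of an orthonormal basis of $R^{3,1}$, so that the
  coordinate $y_0$ of \<open>y\<close> is \<open>- ip y \<ee>\<close>.
\<close>

definition adapted_frame :: "real^6 \<Rightarrow> real^6 \<Rightarrow> real^6 \<Rightarrow> bool"
  where "adapted_frame \<pp> \<qq> \<ee> \<longleftrightarrow>
    ip \<pp> \<pp> = -1 \<and> ip \<qq> \<qq> = 1 \<and> ip \<ee> \<ee> = -1 \<and> ip \<pp> \<qq> = 0 \<and> ip \<pp> \<ee> = 0 \<and> ip \<qq> \<ee> = 0"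

definition R31 :: "real^6 \<Rightarrow> real^6 \<Rightarrow> (real^6) set"
  where "R31 \<pp> \<qq> = {y. ip y \<pp> = 0 \<and> ip y \<qq> = 0}"

definition H3 :: "real^6 \<Rightarrow> real^6 \<Rightarrow> real^6 \<Rightarrow> (real^6) set"
  where "H3 \<pp> \<qq> \<ee> = {y \<in> R31 \<pp> \<qq>. ip y y = -1 \<and> - ip y \<ee> > 0}"

definition S21 :: "real^6 \<Rightarrow> real^6 \<Rightarrow> (real^6) set"
  where "S21 \<pp> \<qq> = {y \<in> R31 \<pp> \<qq>. ip y y = 1}"

section \<open>Legendre maps\<close>

definition null_plane :: "(real^6) set \<Rightarrow> bool"
  where "null_plane P \<longleftrightarrow> subspace P \<and> dim P = 2 \<and> (\<forall>a\<in>P. \<forall>b\<in>P. ip a b = 0)"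

text \<open>Smoothness of a map into the Grassmannian is expressed through smooth local frames.\<close>

definition smooth_null_plane_map :: "(real^2) set \<Rightarrow> (real^2 \<Rightarrow> (real^6) set) \<Rightarrow> bool"
  where "smooth_null_plane_map U f \<longleftrightarrow>
    (\<forall>x\<in>U. null_plane (f x)) \<and>
    (\<forall>x\<in>U. \<exists>V a b. open V \<and> x \<in> V \<and> V \<subseteq> U \<and> smooth_map V a \<and> smooth_map V b \<and>
       (\<forall>y\<in>V. f y = span {a y, b y}))"

definition is_section :: "(real^2) set \<Rightarrow> (real^2 \<Rightarrow> (real^6) set) \<Rightarrow> (real^2 \<Rightarrow> real^6) \<Rightarrow> bool"
  where "is_section U f s \<longleftrightarrow> smooth_map U s \<and> (\<forall>x\<in>U. s x \<in> f x)"

definition legendre_map :: "(real^2) set \<Rightarrow> (real^2 \<Rightarrow> (real^6) set) \<Rightarrow> bool"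
  where "legendre_map U f \<longleftrightarrow>
    smooth_null_plane_map U f \<and>
    (\<forall>s s'. is_section U f s \<longrightarrow> is_section U f s' \<longrightarrow>
       (\<forall>x\<in>U. \<forall>X. ip (dirderiv s x X) (s' x) = 0)) \<and>
    (\<forall>x\<in>U. \<forall>X. (\<forall>s. is_section U f s \<longrightarrow> dirderiv s x X \<in> f x) \<longrightarrow> X = 0)"

section \<open>Intrinsic Gauss curvature\<close>

text \<open>
  A metric on a coordinate domain is given by its Gram matrix. The curvature is
  $g(R(\partial_1,\partial_2)\partial_2,\partial_1) / \det g$ for the Levi-Civita connection.
\<close>

definition christoffel :: "(real^2 \<Rightarrow> real^2^2) \<Rightarrow> 2 \<Rightarrow> 2 \<Rightarrow> 2 \<Rightarrow> real^2 \<Rightarrow> real"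
  where "christoffel g k i j x =
    (\<Sum>l\<in>UNIV. matrix_inv (g x) $ k $ l *
       (pderivative i (\<lambda>y. g y $ j $ l) x + pderivative j (\<lambda>y. g y $ i $ l) x
        - pderivative l (\<lambda>y. g y $ i $ j) x)) / 2"

definition riemann :: "(real^2 \<Rightarrow> real^2^2) \<Rightarrow> 2 \<Rightarrow> 2 \<Rightarrow> 2 \<Rightarrow> 2 \<Rightarrow> real^2 \<Rightarrow> real"
  \<comment> \<open>the \<open>l\<close>-th component of $R(\partial_i,\partial_j)\partial_k$\<close>
  where "riemann g l i j k x =
    pderivative i (christoffel g l j k) x - pderivative j (christoffel g l i k) x
    + (\<Sum>m\<in>UNIV. christoffel g m j k x * christoffel g l i m x
                 - christoffel g m i k x * christoffel g l j m x)"

definition gauss_curvature :: "(real^2 \<Rightarrow> real^2^2) \<Rightarrow> real^2 \<Rightarrow> real"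
  where "gauss_curvature g x = (\<Sum>l\<in>UNIV. g x $ l $ 1 * riemann g l 1 2 2 x) / det (g x)"

definition induced_metric :: "(real^2 \<Rightarrow> real^6) \<Rightarrow> real^2 \<Rightarrow> real^2^2"
  where "induced_metric h x = (\<chi> i j. ip (pderivative i h x) (pderivative j h x))"

definition immersed_at :: "(real^2 \<Rightarrow> real^6) \<Rightarrow> real^2 \<Rightarrow> bool"
  where "immersed_at h x \<longleftrightarrow> h differentiable (at x) \<and> inj (dirderiv h x)"

section \<open>Flat fronts in hyperbolic space\<close>

definition legendre_lift ::
    "real^6 \<Rightarrow> real^6 \<Rightarrow> (real^2 \<Rightarrow> real^6) \<Rightarrow> (real^2 \<Rightarrow> real^6) \<Rightarrow> real^2 \<Rightarrow> (real^6) set"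
  where "legendre_lift \<pp> \<qq> \<ff> \<tt> x = span {\<qq> + \<ff> x, \<pp> + \<tt> x}"

definition front ::
    "real^6 \<Rightarrow> real^6 \<Rightarrow> real^6 \<Rightarrow> (real^2) set \<Rightarrow> (real^2 \<Rightarrow> real^6) \<Rightarrow> (real^2 \<Rightarrow> real^6) \<Rightarrow> bool"
  where "front \<pp> \<qq> \<ee> U \<ff> \<tt> \<longleftrightarrow>
    smooth_map U \<ff> \<and> smooth_map U \<tt> \<and>
    (\<forall>x\<in>U. \<ff> x \<in> H3 \<pp> \<qq> \<ee> \<and> \<tt> x \<in> S21 \<pp> \<qq> \<and> ip (\<tt> x) (\<ff> x) = 0 \<and>
       (\<forall>X. ip (\<tt> x) (dirderiv \<ff> x X) = 0)) \<and>
    legendre_map U (legendre_lift \<pp> \<qq> \<ff> \<tt>)"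

definition parallel_front ::
    "real \<Rightarrow> (real^2 \<Rightarrow> real^6) \<Rightarrow> (real^2 \<Rightarrow> real^6) \<Rightarrow> real^2 \<Rightarrow> real^6"
  where "parallel_front r \<ff> \<tt> x = cosh r *\<^sub>R \<ff> x + sinh r *\<^sub>R \<tt> x"

definition flat_front ::
    "real^6 \<Rightarrow> real^6 \<Rightarrow> real^6 \<Rightarrow> (real^2) set \<Rightarrow> (real^2 \<Rightarrow> real^6) \<Rightarrow> (real^2 \<Rightarrow> real^6) \<Rightarrow> bool"
  where "flat_front \<pp> \<qq> \<ee> U \<ff> \<tt> \<longleftrightarrow>
    front \<pp> \<qq> \<ee> U \<ff> \<tt> \<and>
    (\<forall>r. \<forall>x\<in>U. immersed_at (parallel_front r \<ff> \<tt>) x \<longrightarrow>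
       gauss_curvature (induced_metric (parallel_front r \<ff> \<tt>)) x = 0)"

text \<open>
  The points of the coordinate domain are \<open>(u, v) = (x $ 1, x $ 2)\<close>. The two curvature spheres
  spanned by $s_1 = \cosh\varphi\,(p+t) + \sinh\varphi\,(q+f)$ and
  $s_2 = \sinh\varphi\,(p+t) + \cosh\varphi\,(q+f)$ are distinct at every point, so
  a front admitting such coordinates on all of \<open>U\<close> is free of umbilics.
\<close>

definition curvature_line_coordinates ::
    "(real^2) set \<Rightarrow> (real^2 \<Rightarrow> real^6) \<Rightarrow> (real^2 \<Rightarrow> real^6) \<Rightarrow> (real^2 \<Rightarrow> real) \<Rightarrow> bool"
  where "curvature_line_coordinates U \<ff> \<tt> \<phi> \<longleftrightarrow>
    smooth_map U \<phi> \<and>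
    (\<forall>x\<in>U. cosh (\<phi> x) *\<^sub>R pderivative 1 \<tt> x + sinh (\<phi> x) *\<^sub>R pderivative 1 \<ff> x = 0 \<and>
           sinh (\<phi> x) *\<^sub>R pderivative 2 \<tt> x + cosh (\<phi> x) *\<^sub>R pderivative 2 \<ff> x = 0)"

section \<open>Lie geometric deformation\<close>

definition s_plus ::
    "real^6 \<Rightarrow> real^6 \<Rightarrow> (real^2 \<Rightarrow> real^6) \<Rightarrow> (real^2 \<Rightarrow> real^6) \<Rightarrow> (real^2 \<Rightarrow> real) \<Rightarrow> real^2 \<Rightarrow> real^6"
  where "s_plus \<pp> \<qq> \<ff> \<tt> \<phi> x = exp (\<phi> x) *\<^sub>R (\<pp> + \<qq> + \<tt> x + \<ff> x)"

definition s_minus ::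
    "real^6 \<Rightarrow> real^6 \<Rightarrow> (real^2 \<Rightarrow> real^6) \<Rightarrow> (real^2 \<Rightarrow> real^6) \<Rightarrow> (real^2 \<Rightarrow> real) \<Rightarrow> real^2 \<Rightarrow> real^6"
  where "s_minus \<pp> \<qq> \<ff> \<tt> \<phi> x = exp (- \<phi> x) *\<^sub>R (\<pp> - \<qq> + \<tt> x - \<ff> x)"

text \<open>The Hodge-type operator on 1-forms, $(\star\alpha)(X) = \alpha(\star X)$.\<close>

definition star_vec :: "real^2 \<Rightarrow> real^2"
  where "star_vec X = vector [X $ 1, - X $ 2]"

definition tau ::
    "real^6 \<Rightarrow> real^6 \<Rightarrow> (real^2 \<Rightarrow> real^6) \<Rightarrow> (real^2 \<Rightarrow> real^6) \<Rightarrow> (real^2 \<Rightarrow> real) \<Rightarrow>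
     real^2 \<Rightarrow> real^2 \<Rightarrow> real^6^6"
  where "tau \<pp> \<qq> \<ff> \<tt> \<phi> x X =
    (let sp = s_plus \<pp> \<qq> \<ff> \<tt> \<phi>; sm = s_minus \<pp> \<qq> \<ff> \<tt> \<phi>
     in wedge (sp x) (dirderiv sp x (star_vec X))
        + (1/2) *\<^sub>R dirderiv (\<lambda>y. wedge (sp y) (sm y)) x X)"

definition gauge_solution ::
    "real^6 \<Rightarrow> real^6 \<Rightarrow> (real^2) set \<Rightarrow> (real^2 \<Rightarrow> real^6) \<Rightarrow> (real^2 \<Rightarrow> real^6) \<Rightarrow> (real^2 \<Rightarrow> real) \<Rightarrow>
     real \<Rightarrow> (real^2 \<Rightarrow> real^6^6) \<Rightarrow> bool"
  where "gauge_solution \<pp> \<qq> U \<ff> \<tt> \<phi> lam T \<longleftrightarrow>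
    (\<forall>x\<in>U. T x \<in> O42 \<and>
       (T has_derivative (\<lambda>X. T x ** (lam *\<^sub>R tau \<pp> \<qq> \<ff> \<tt> \<phi> x X))) (at x))"

definition transformed ::
    "(real^2 \<Rightarrow> real^6^6) \<Rightarrow> (real^2 \<Rightarrow> (real^6) set) \<Rightarrow> real^2 \<Rightarrow> (real^6) set"
  where "transformed T f x = (\<lambda>y. T x *v y) ` f x"

end

theory Submission
  imports Defs
begin

text \<open>
  The form $\tau$ annihilates the lift, so $d(T(q+f)) = T\,df$ and $d(T(p+t)) = T\,dt$, while
  $T((1-\lambda)p - \lambda t)$ and $T((1-\lambda)q - \lambda f)$ are constant, orthogonal, and of square
  lengths $\mp(1-2\lambda)$. For $\lambda \neq \frac12$, a constant orthogonal transformation moves their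
  normalizations to $p, q$ (to $-q, -p$ if $\lambda > \frac12$). The rescaled lift sections then have the form
  $q + f'$, $p + t'$, and $df', dt'$ are, up to a constant factor and a pointwise isometry, $df, dt$
  (or $dt, df$). Flatness survives the exchange because in curvature line coordinates the metrics
  $E\cosh^2(\varphi-r)\,du^2 + G\sinh^2(\varphi-r)\,dv^2$ and
  $E\sinh^2(\varphi-r)\,du^2 + G\cosh^2(\varphi-r)\,dv^2$ with $E = E(u)$, $G = G(v)$ are flat under
  one and the same condition on $\varphi, E, G$.
\<close>

section \<open>Smooth maps\<close>

text \<open>The conserved vectors are p - \<open>lam\<close> (p + t) and q - \<open>lam\<close> (q +
  f), so p and q are corrected by null sections of the lift. Their pairings with the lift therefore
  do not depend on \<open>lam\<close>; only their square lengths do, and at \<open>lam\<close> = 1/2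
  both vectors become null while staying orthogonal, so that they no longer span a plane of
  signature (1,1). Beyond 1/2 the timelike one is the descendant of q, hence the exchange of f and
  t. After the exchange the metric of the new front is a multiple of (dt, dt), which is not among
  the metrics assumed flat. The curvature is therefore reduced to a condition free of the parallel
  parameter; flatness of the given front yields it at each single point through a parallel front
  that immerses there. The condition y_0 > 0 is not invariant under O(4,2). It is met by normalizing
  a third vector at one base point and is carried to the whole domain by connectedness.\<close>

lemma dirderiv_eqI: "(g has_derivative g') (at x) \<Longrightarrow> dirderiv g x X = g' X"
  using frechet_derivative_at by metis

lemma dirderiv_has_derivative:
  "g differentiable (at x) \<Longrightarrow> (g has_derivative dirderiv g x) (at x)"
  by (simp add: frechet_derivative_works)

text \<open>The chosen derivative depends only on the predicate \<open>has_derivative\<close>, which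
  is the same for both maps at \<open>x\<close>; this also covers points where neither is
  differentiable.\<close>

lemma dirderiv_cong:
  assumes "open U" "x \<in> U" "\<And>y. y \<in> U \<Longrightarrow> f y = g y"
  shows "dirderiv f x X = dirderiv g x X"
proof -
  have "(f has_derivative D) (at x) = (g has_derivative D) (at x)" for D
    using has_derivative_transform_within_open[OF _ assms(1,2), of f D UNIV g]
      has_derivative_transform_within_open[OF _ assms(1,2), of g D UNIV f] assms(3) by auto
  then show ?thesis
    by (simp add: frechet_derivative_def)
qed

lemma dirderiv_const_on:
  assumes "open U" "x \<in> U" "\<And>y. y \<in> U \<Longrightarrow> f y = c"
  shows "dirderiv f x X = 0"
  using dirderiv_cong[OF assms(1,2), of f "\<lambda>_. c"] assms(3) by simp

lemma differentiable_cong_open: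
  assumes "open U" "x \<in> U" "\<And>y. y \<in> U \<Longrightarrow> f y = g y" "f differentiable (at x)"
  shows "g differentiable (at x)"
  using has_derivative_transform_within_open[OF _ assms(1,2), of f _ UNIV g] assms(3,4)
  unfolding differentiable_def by auto

section \<open>Stability of the classes \<open>cont_diff\<close> under congruence, sums and bilinear
  maps\<close>

lemma cont_diff_cong:
  assumes "open U" "\<And>y. y \<in> U \<Longrightarrow> f y = g y" "cont_diff k U f"
  shows "cont_diff k U g"
  using assms(2,3)
proof (induction k arbitrary: f g)
  case 0
  then show ?case by (simp cong: continuous_on_cong)
next
  case (Suc k)
  have "cont_diff k U (\<lambda>x. dirderiv g x X)" for X
    by (rule Suc.IH[of "\<lambda>x. dirderiv f x X"])
      (use Suc.prems dirderiv_cong[OF assms(1), of _ f g] in auto)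
  moreover have "g differentiable (at x)" if "x \<in> U" for x
    by (rule differentiable_cong_open[OF assms(1) that Suc.prems(1)]) (use Suc.prems that in auto)
  ultimately show ?case
    unfolding cont_diff.simps by blast
qed

lemma cont_diff_Suc_imp: "cont_diff (Suc k) U f \<Longrightarrow> cont_diff k U f"
proof (induction k arbitrary: f)
  case 0
  then show ?case
    by (simp add: continuous_at_imp_continuous_on differentiable_imp_continuous_within)
next
  case (Suc k)
  then show ?case by (metis cont_diff.simps(2))
qed

lemma cont_diff_const: "cont_diff k U (\<lambda>_. c)"
  by (induction k arbitrary: c) auto

lemma cont_diff_add:
  assumes "open U" "cont_diff k U f" "cont_diff k U g"
  shows "cont_diff k U (\<lambda>x. f x + g x)"
  using assms(2,3)
proof (induction k arbitrary: f g)
  case 0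
  then show ?case by (simp add: continuous_on_add)
next
  case (Suc k)
  have "cont_diff k U (\<lambda>x. dirderiv (\<lambda>y. f y + g y) x X)" for X
  proof (rule cont_diff_cong[OF assms(1)])
    show "cont_diff k U (\<lambda>x. dirderiv f x X + dirderiv g x X)"
      using Suc by simp
    fix x assume "x \<in> U"
    then have "((\<lambda>y. f y + g y) has_derivative (\<lambda>X. dirderiv f x X + dirderiv g x X)) (at x)"
      using Suc.prems by (intro has_derivative_add dirderiv_has_derivative) auto
    then show "dirderiv f x X + dirderiv g x X = dirderiv (\<lambda>y. f y + g y) x X"
      by (rule dirderiv_eqI[symmetric])
  qed
  moreover have "(\<lambda>y. f y + g y) differentiable (at x)" if "x \<in> U" for x
    using Suc.prems that by (intro differentiable_add) auto
  ultimately show ?case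
    unfolding cont_diff.simps by blast
qed

text \<open>The Leibniz rule writes the derivative as two terms of the same bilinear shape, so the
  induction closes; \<open>cont_diff_Suc_imp\<close> serves the undifferentiated factors. One
  statement covers scaling, \<open>wedge\<close>, inner and matrix products.\<close>

lemma bounded_bilinear_cont_diff:
  assumes "bounded_bilinear h" "open U" "cont_diff k U f" "cont_diff k U g"
  shows "cont_diff k U (\<lambda>x. h (f x) (g x))"
  using assms(3,4)
proof (induction k arbitrary: f g)
  case 0
  then show ?case
    by (simp add: continuous_on bounded_bilinear.tendsto[OF assms(1)])
next
  case (Suc k)
  have D: "((\<lambda>y. h (f y) (g y)) has_derivative
      (\<lambda>X. h (f x) (dirderiv g x X) + h (dirderiv f x X) (g x))) (at x)" if "x \<in> U" for x
    using Suc.prems that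
    by (intro bounded_bilinear.FDERIV[OF assms(1)] dirderiv_has_derivative) auto
  have "cont_diff k U (\<lambda>x. dirderiv (\<lambda>y. h (f y) (g y)) x X)" for X
  proof (rule cont_diff_cong[OF assms(2)])
    show "cont_diff k U (\<lambda>x. h (f x) (dirderiv g x X) + h (dirderiv f x X) (g x))"
      using Suc.prems Suc.prems[THEN cont_diff_Suc_imp]
      by (intro cont_diff_add[OF assms(2)] Suc.IH) simp_all
  qed (simp add: dirderiv_eqI[OF D])
  moreover have "(\<lambda>y. h (f y) (g y)) differentiable (at x)" if "x \<in> U" for x
    using D[OF that] by (rule differentiableI)
  ultimately show ?case
    unfolding cont_diff.simps by blast
qed

lemma smooth_map_const: "smooth_map U (\<lambda>_. c)"
  by (simp add: smooth_map_def cont_diff_const)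

lemma smooth_map_add:
  "open U \<Longrightarrow> smooth_map U f \<Longrightarrow> smooth_map U g \<Longrightarrow> smooth_map U (\<lambda>x. f x + g x)"
  by (simp add: smooth_map_def cont_diff_add)

lemma bounded_bilinear_smooth_map:
  assumes "bounded_bilinear h" "open U" "smooth_map U f" "smooth_map U g"
  shows "smooth_map U (\<lambda>x. h (f x) (g x))"
  using assms by (simp add: smooth_map_def bounded_bilinear_cont_diff)

lemma smooth_map_scaleR:
  assumes "open U" "smooth_map U g"
  shows "smooth_map U (\<lambda>x. c *\<^sub>R g x)"
  using bounded_bilinear_smooth_map[OF bounded_bilinear_scaleR assms(1) smooth_map_const assms(2)] .

lemma smooth_map_diff:
  assumes "open U" "smooth_map U f" "smooth_map U g"
  shows "smooth_map U (\<lambda>x. f x - g x)"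
  using smooth_map_add[OF assms(1,2) smooth_map_scaleR[OF assms(1,3), of "-1"]] by simp

lemma smooth_map_dirderiv: "smooth_map U f \<Longrightarrow> smooth_map U (\<lambda>x. dirderiv f x X)"
  unfolding smooth_map_def by (metis cont_diff.simps(2))

lemma smooth_map_differentiable: "smooth_map U f \<Longrightarrow> x \<in> U \<Longrightarrow> f differentiable (at x)"
  unfolding smooth_map_def by (metis cont_diff.simps(2))

lemma smooth_map_has_derivative:
  "smooth_map U f \<Longrightarrow> x \<in> U \<Longrightarrow> (f has_derivative dirderiv f x) (at x)"
  by (simp add: dirderiv_has_derivative smooth_map_differentiable)

lemma smooth_map_continuous_on: "smooth_map U f \<Longrightarrow> continuous_on U f"
  unfolding smooth_map_def by (metis cont_diff.simps(1))

lemma dirderiv_linear_combination: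
  fixes g :: "real^2 \<Rightarrow> 'b::real_normed_vector"
  assumes "g differentiable (at x)"
  shows "dirderiv g x X = X $ 1 *\<^sub>R pderivative 1 g x + X $ 2 *\<^sub>R pderivative 2 g x"
proof -
  have X: "X = X $ 1 *\<^sub>R axis 1 1 + X $ 2 *\<^sub>R axis 2 1"
    by (simp add: vec_eq_iff forall_2 axis_def)
  have "linear (dirderiv g x)"
    using assms by (rule linear_frechet_derivative)
  then show ?thesis
    by (subst X) (simp add: linear_add linear_scale)
qed

text \<open>Symmetry of second derivatives: the double difference over a small parallelogram equals
  either mixed derivative at some intermediate point.\<close>

lemma double_difference_mean_value:
  fixes g :: "'a::euclidean_space \<Rightarrow> real"
  assumes h: "h > 0"
    and U: "\<And>r s. 0 \<le> r \<Longrightarrow> r \<le> h \<Longrightarrow> 0 \<le> s \<Longrightarrow> s \<le> h \<Longrightarrow> x + r *\<^sub>R X + s *\<^sub>R Y \<in> U"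
    and d: "\<And>y. y \<in> U \<Longrightarrow> g differentiable (at y)"
    and dd: "\<And>y. y \<in> U \<Longrightarrow> (\<lambda>z. dirderiv g z X) differentiable (at y)"
  shows "\<exists>r s. 0 < r \<and> r < h \<and> 0 < s \<and> s < h \<and>
    g (x + h *\<^sub>R X + h *\<^sub>R Y) - g (x + h *\<^sub>R X) - g (x + h *\<^sub>R Y) + g x
    = h * h * dirderiv (\<lambda>z. dirderiv g z X) (x + r *\<^sub>R X + s *\<^sub>R Y) Y"
proof -
  have D: "((\<lambda>r. g (x + r *\<^sub>R X + s *\<^sub>R Y)) has_field_derivative
      dirderiv g (x + r *\<^sub>R X + s *\<^sub>R Y) X) (at r)"
    if "0 \<le> r" "r \<le> h" "0 \<le> s" "s \<le> h" for r s
  proof -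
    have "((\<lambda>r. x + r *\<^sub>R X + s *\<^sub>R Y) has_derivative (\<lambda>t. t *\<^sub>R X)) (at r)"
      by (auto intro!: derivative_eq_intros)
    from has_derivative_compose[OF this dirderiv_has_derivative[OF d[OF U[OF that]]]]
    show ?thesis
      by (simp add: has_field_derivative_def mult_commute_abs
          linear_scale[OF linear_frechet_derivative[OF d[OF U[OF that]]]])
  qed
  have "\<exists>r. 0 < r \<and> r < h \<and>
      (g (x + h *\<^sub>R X + h *\<^sub>R Y) - g (x + h *\<^sub>R X + 0 *\<^sub>R Y)) -
      (g (x + 0 *\<^sub>R X + h *\<^sub>R Y) - g (x + 0 *\<^sub>R X + 0 *\<^sub>R Y)) =
      (h - 0) * (dirderiv g (x + r *\<^sub>R X + h *\<^sub>R Y) X - dirderiv g (x + r *\<^sub>R X + 0 *\<^sub>R Y) X)"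
    using h by (intro MVT2 DERIV_diff D) auto
  then obtain r where r: "0 < r" "r < h"
    and r_eq: "g (x + h *\<^sub>R X + h *\<^sub>R Y) - g (x + h *\<^sub>R X) - (g (x + h *\<^sub>R Y) - g x) =
      h * (dirderiv g (x + r *\<^sub>R X + h *\<^sub>R Y) X - dirderiv g (x + r *\<^sub>R X) X)"
    by auto
  have D2: "((\<lambda>s. dirderiv g (x + r *\<^sub>R X + s *\<^sub>R Y) X) has_field_derivative
      dirderiv (\<lambda>z. dirderiv g z X) (x + r *\<^sub>R X + s *\<^sub>R Y) Y) (at s)"
    if "0 \<le> s" "s \<le> h" for s
  proof -
    have i: "x + r *\<^sub>R X + s *\<^sub>R Y \<in> U"
      using r that by (intro U) auto
    have "((\<lambda>s. x + r *\<^sub>R X + s *\<^sub>R Y) has_derivative (\<lambda>t. t *\<^sub>R Y)) (at s)"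
      by (auto intro!: derivative_eq_intros)
    from has_derivative_compose[OF this dirderiv_has_derivative[OF dd[OF i]]]
    show ?thesis
      by (simp add: has_field_derivative_def mult_commute_abs
          linear_scale[OF linear_frechet_derivative[OF dd[OF i]]])
  qed
  have "\<exists>s. 0 < s \<and> s < h \<and>
      dirderiv g (x + r *\<^sub>R X + h *\<^sub>R Y) X - dirderiv g (x + r *\<^sub>R X + 0 *\<^sub>R Y) X =
      (h - 0) * dirderiv (\<lambda>z. dirderiv g z X) (x + r *\<^sub>R X + s *\<^sub>R Y) Y"
    using h by (intro MVT2 D2) auto
  then obtain s where s: "0 < s" "s < h"
    and s_eq: "dirderiv g (x + r *\<^sub>R X + h *\<^sub>R Y) X - dirderiv g (x + r *\<^sub>R X) X =
      h * dirderiv (\<lambda>z. dirderiv g z X) (x + r *\<^sub>R X + s *\<^sub>R Y) Y"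
    by auto
  show ?thesis
    using r s r_eq by (intro exI[of _ r] exI[of _ s]) (simp add: s_eq)
qed

text \<open>If the mixed derivatives differed at \<open>x\<close>, continuity would keep their
  values apart on a small parallelogram, whereas the double difference makes a value of one equal to
  a value of the other there.\<close>

lemma symmetric_second_dirderiv_real:
  fixes g :: "'a::euclidean_space \<Rightarrow> real"
  assumes "open U" "smooth_map U g" "x \<in> U"
  shows "dirderiv (\<lambda>z. dirderiv g z X) x Y = dirderiv (\<lambda>z. dirderiv g z Y) x X"
    (is "?F x = ?G x")
proof (rule ccontr)
  assume ne: "?F x \<noteq> ?G x"
  define e where "e = dist (?F x) (?G x) / 2"
  have e: "e > 0" using ne by (simp add: e_def)
  have F: "isCont ?F x" and G: "isCont ?G x"
    using smooth_map_continuous_on[OF smooth_map_dirderiv[OF smooth_map_dirderiv[OF assms(2)]]]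
      continuous_on_eq_continuous_at[OF assms(1)] assms(3) by blast+
  from F e obtain d1 where d1: "d1 > 0" "\<And>y. dist y x < d1 \<Longrightarrow> dist (?F y) (?F x) < e"
    unfolding continuous_at_eps_delta by metis
  from G e obtain d2 where d2: "d2 > 0" "\<And>y. dist y x < d2 \<Longrightarrow> dist (?G y) (?G x) < e"
    unfolding continuous_at_eps_delta by metis
  from assms obtain d3 where d3: "d3 > 0" "ball x d3 \<subseteq> U"
    by (meson open_contains_ball)
  define d where "d = min d1 (min d2 d3)"
  \<comment> \<open>The summand 1 keeps \<open>h\<close> positive and the estimate below strict even
    for \<open>X\<close> = \<open>Y\<close> = 0.\<close>
  define h where "h = d / (norm X + norm Y + 1)"
  have d: "d > 0" using d1 d2 d3 by (simp add: d_def)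
  have N: "norm X + norm Y + 1 > 0" by (simp add: add_nonneg_pos)
  then have h: "h > 0" using d by (simp add: h_def)
  have near: "dist (x + r *\<^sub>R X + s *\<^sub>R Y) x < d" if "0 \<le> r" "r \<le> h" "0 \<le> s" "s \<le> h" for r s
  proof -
    have "dist (x + r *\<^sub>R X + s *\<^sub>R Y) x \<le> norm (r *\<^sub>R X) + norm (s *\<^sub>R Y)"
      by (simp add: dist_norm norm_triangle_ineq add.assoc del: norm_scaleR)
    also have "\<dots> \<le> h * norm X + h * norm Y"
      using that by (auto intro!: add_mono mult_right_mono)
    also have "\<dots> < h * (norm X + norm Y + 1)"
      using h by (simp add: algebra_simps)
    also have "\<dots> = d" using N by (simp add: h_def)
    finally show ?thesis .
  qed
  have inU: "x + r *\<^sub>R X + s *\<^sub>R Y \<in> U" "x + s *\<^sub>R Y + r *\<^sub>R X \<in> U"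
    if "0 \<le> r" "r \<le> h" "0 \<le> s" "s \<le> h" for r s
    using near[OF that] d3(2) by (auto simp: d_def dist_commute add_ac)
  have diff: "g differentiable (at y)" "(\<lambda>z. dirderiv g z V) differentiable (at y)" if "y \<in> U" for y V
    using assms that smooth_map_differentiable smooth_map_dirderiv by blast+
  obtain r s where rs: "0 < r" "r < h" "0 < s" "s < h"
    "g (x + h *\<^sub>R X + h *\<^sub>R Y) - g (x + h *\<^sub>R X) - g (x + h *\<^sub>R Y) + g x
     = h * h * ?F (x + r *\<^sub>R X + s *\<^sub>R Y)"
    using double_difference_mean_value[of h x X Y U g, OF h inU(1) diff(1) diff(2)] by auto
  obtain r' s' where rs': "0 < r'" "r' < h" "0 < s'" "s' < h"
    "g (x + h *\<^sub>R Y + h *\<^sub>R X) - g (x + h *\<^sub>R Y) - g (x + h *\<^sub>R X) + g x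
     = h * h * ?G (x + r' *\<^sub>R Y + s' *\<^sub>R X)"
    using double_difference_mean_value[of h x Y X U g, OF h inU(2) diff(1) diff(2)] by auto
  have "h * h * ?F (x + r *\<^sub>R X + s *\<^sub>R Y) = h * h * ?G (x + s' *\<^sub>R X + r' *\<^sub>R Y)"
    using rs(5) rs'(5) by (simp add: algebra_simps)
  then have "?F (x + r *\<^sub>R X + s *\<^sub>R Y) = ?G (x + s' *\<^sub>R X + r' *\<^sub>R Y)"
    using h by simp
  moreover have "dist (?F (x + r *\<^sub>R X + s *\<^sub>R Y)) (?F x) < e"
    using near[of r s] rs by (intro d1(2)) (auto simp: d_def)
  moreover have "dist (?G (x + s' *\<^sub>R X + r' *\<^sub>R Y)) (?G x) < e"
    using near[of s' r'] rs' by (intro d2(2)) (auto simp: d_def)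
  ultimately have "dist (?F x) (?G x) < e + e"
    using dist_triangle2[of "?F x" "?G x" "?F (x + r *\<^sub>R X + s *\<^sub>R Y)"]
    by (simp add: dist_commute)
  then show False by (simp add: e_def)
qed

lemma symmetric_second_dirderiv:
  fixes g :: "'a::euclidean_space \<Rightarrow> 'b::euclidean_space"
  assumes "open U" "smooth_map U g" "x \<in> U"
  shows "dirderiv (\<lambda>z. dirderiv g z X) x Y = dirderiv (\<lambda>z. dirderiv g z Y) x X"
proof (rule euclidean_eqI)
  fix b :: 'b assume "b \<in> Basis"
  have D: "dirderiv (\<lambda>z. f z \<bullet> b) y V = dirderiv f y V \<bullet> b"
    if "smooth_map U f" "y \<in> U" for f :: "'a \<Rightarrow> 'b" and y V
    using that by (intro dirderiv_eqI has_derivative_inner_left smooth_map_has_derivative)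
  have DD: "dirderiv (\<lambda>z. dirderiv g z V) x W \<bullet> b
      = dirderiv (\<lambda>z. dirderiv (\<lambda>y. g y \<bullet> b) z V) x W" for V W
    using D[OF smooth_map_dirderiv[OF assms(2)] assms(3)] D[OF assms(2)]
      dirderiv_cong[OF assms(1,3), of "\<lambda>z. dirderiv (\<lambda>y. g y \<bullet> b) z V"
        "\<lambda>z. dirderiv g z V \<bullet> b"] by metis
  have "smooth_map U (\<lambda>y. g y \<bullet> b)"
    using bounded_bilinear_smooth_map[OF bounded_bilinear_inner assms(1,2) smooth_map_const] .
  from symmetric_second_dirderiv_real[OF assms(1) this assms(3)]
  show "dirderiv (\<lambda>z. dirderiv g z X) x Y \<bullet> b = dirderiv (\<lambda>z. dirderiv g z Y) x X \<bullet> b"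
    unfolding DD .
qed

section \<open>Linear algebra in signature (4,2)\<close>

lemma bounded_bilinear_ip: "bounded_bilinear ip"
  by (simp add: bilinear_conv_bounded_bilinear[symmetric] bilinear_def linear_iff ip_def algebra_simps)

interpretation ip: bounded_bilinear ip
  by (rule bounded_bilinear_ip)

lemmas ip_simps = ip.add_left ip.add_right ip.diff_left ip.diff_right ip.minus_left ip.minus_right
  ip.scaleR_left ip.scaleR_right ip.zero_left ip.zero_right

lemma ip_commute: "ip x y = ip y x"
  by (simp add: ip_def mult.commute)

lemma bounded_bilinear_wedge: "bounded_bilinear wedge"
  by (simp add: bilinear_conv_bounded_bilinear[symmetric] bilinear_def linear_iff matrix_eq
      wedge_mult_vec matrix_vector_mult_add_rdistrib ip_simps algebra_simps
      scaleR_matrix_vector_assoc[symmetric])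

interpretation wedge: bounded_bilinear wedge
  by (rule bounded_bilinear_wedge)

lemma bounded_bilinear_matrix_vector_mult:
  "bounded_bilinear ((*v) :: real^'n^'m \<Rightarrow> real^'n \<Rightarrow> real^'m)"
  by (simp add: bilinear_conv_bounded_bilinear[symmetric] bilinear_def linear_iff
      matrix_vector_mult_add_rdistrib algebra_simps scaleR_matrix_vector_assoc[symmetric])

lemma bounded_bilinear_matrix_mult:
  "bounded_bilinear ((**) :: real^'n^'m \<Rightarrow> real^'k^'n \<Rightarrow> real^'k^'m)"
  by (simp add: bilinear_conv_bounded_bilinear[symmetric] bilinear_def linear_iff matrix_eq
      matrix_vector_mult_add_rdistrib matrix_vector_mul_assoc[symmetric] algebra_simps
      scaleR_matrix_vector_assoc[symmetric])

lemma O42_ip: "A \<in> O42 \<Longrightarrow> ip (A *v x) (A *v y) = ip x y"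
  by (simp add: O42_def)

lemma O42_mult: "A \<in> O42 \<Longrightarrow> B \<in> O42 \<Longrightarrow> A ** B \<in> O42"
  by (simp add: O42_def matrix_vector_mul_assoc[symmetric])

lemma ip_nondegenerate:
  assumes "\<And>y. ip x y = 0"
  shows "x = 0"
proof -
  have "x $ 1 = 0 \<and> x $ 2 = 0 \<and> x $ 3 = 0 \<and> x $ 4 = 0 \<and> x $ 5 = 0 \<and> x $ 6 = 0"
    using assms[of "axis 1 1"] assms[of "axis 2 1"] assms[of "axis 3 1"] assms[of "axis 4 1"]
      assms[of "axis 5 1"] assms[of "axis 6 1"] by (simp add: ip_def axis_def)
  \<comment> \<open>In the type \<open>6\<close> the numeral \<open>6\<close> equals
    \<open>0\<close>, so the representative \<open>z = 0\<close> stands for the sixth index.\<close>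
  moreover have "i \<in> {1, 2, 3, 4, 5, 6}" for i :: 6
  proof (cases i)
    case (of_int z)
    then have "z = 0 \<or> z = 1 \<or> z = 2 \<or> z = 3 \<or> z = 4 \<or> z = 5"
      by (simp, presburger)
    then show ?thesis
      using of_int(1) by auto
  qed
  ultimately have "x $ i = 0" for i
    by (metis empty_iff insert_iff)
  then show ?thesis
    by (simp add: vec_eq_iff)
qed

text \<open>An isometry of a nondegenerate form is injective: a vector sent to 0 is orthogonal to
  everything.\<close>

lemma O42_mult_eq_0_iff: "A \<in> O42 \<Longrightarrow> A *v x = 0 \<longleftrightarrow> x = 0"
  by (metis O42_ip ip.zero_left ip_nondegenerate matrix_vector_mult_0_right)

lemma zero_if_timelike_part_zero:
  fixes w :: "real^6"
  assumes "w $ 5 = 0" "w $ 6 = 0" "ip w w \<le> 0"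
  shows "w = 0"
proof -
  have "(w $ 1)\<^sup>2 + (w $ 2)\<^sup>2 + (w $ 3)\<^sup>2 + (w $ 4)\<^sup>2 \<le> 0"
    using assms by (simp add: ip_def power2_eq_square)
  then have "w $ 1 = 0 \<and> w $ 2 = 0 \<and> w $ 3 = 0 \<and> w $ 4 = 0"
    by (smt (verit) zero_le_power2 zero_less_power2)
  then show ?thesis
    using assms(1,2) by (intro ip_nondegenerate) (simp add: ip_def)
qed

text \<open>A negative semidefinite subspace projects injectively to the last two coordinates, so it
  cannot contain a third vector besides two orthonormal timelike ones.\<close>

lemma orthogonal_to_timelike_plane:
  assumes a: "ip a a = -1" and b: "ip b b = -1" and ab: "ip a b = 0"
    and xa: "ip x a = 0" and xb: "ip x b = 0" and x: "x \<noteq> 0"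
  shows "ip x x > 0"
proof (rule ccontr)
  assume "\<not> ip x x > 0"
  then have xx: "ip x x \<le> 0" by simp
  \<comment> \<open>This is the minor of \<open>a\<close> and \<open>b\<close> in the two timelike
    coordinates. If it vanished, \<open>w\<close> and \<open>w'\<close> below would be combinations
    of \<open>a\<close> and \<open>b\<close> without timelike part, hence zero, and this would force
    \<open>a\<close> = 0.\<close>
  define \<gamma> where "\<gamma> = a $ 5 * b $ 6 - a $ 6 * b $ 5"
  have ba: "ip b a = 0" "ip a x = 0" "ip b x = 0"
    using ab xa xb by (simp_all add: ip_commute)
  have "\<gamma> \<noteq> 0"
  proof
    assume "\<gamma> = 0"
    define w w' where "w = b $ 5 *\<^sub>R a - a $ 5 *\<^sub>R b" and "w' = b $ 6 *\<^sub>R a - a $ 6 *\<^sub>R b"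
    have n: "ip w w = - (b $ 5)\<^sup>2 - (a $ 5)\<^sup>2" "ip w' w' = - (b $ 6)\<^sup>2 - (a $ 6)\<^sup>2"
      using a b ab ba by (simp_all add: w_def w'_def ip_simps power2_eq_square)
    have le: "ip w w \<le> 0" "ip w' w' \<le> 0"
      by (simp_all add: n)
    have "w = 0"
      using le(1) \<open>\<gamma> = 0\<close> by (intro zero_if_timelike_part_zero) (simp_all add: w_def \<gamma>_def)
    moreover have "w' = 0"
      using le(2) \<open>\<gamma> = 0\<close> by (intro zero_if_timelike_part_zero) (simp_all add: w'_def \<gamma>_def mult.commute)
    ultimately have "ip w w = 0" "ip w' w' = 0"
      by (simp_all add: ip_simps)
    then have "(b $ 5)\<^sup>2 + (a $ 5)\<^sup>2 = 0" "(b $ 6)\<^sup>2 + (a $ 6)\<^sup>2 = 0"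
      using n by linarith+
    then have "a $ 5 = 0" "a $ 6 = 0"
      by (simp_all add: sum_power2_eq_zero_iff)
    then have "a = 0"
      using a by (intro zero_if_timelike_part_zero) auto
    then show False using a by (simp add: ip_simps)
  qed
  \<comment> \<open>Together with \<open>\<gamma>\<close> these are the minors of \<open>a\<close>,
    \<open>b\<close>, \<open>x\<close> in the timelike coordinates; expanding a 3 by 3 determinant
    with a repeated row shows that \<open>w\<close> has no timelike part.\<close>
  define \<alpha> \<beta> where "\<alpha> = b $ 5 * x $ 6 - b $ 6 * x $ 5" and "\<beta> = x $ 5 * a $ 6 - x $ 6 * a $ 5"
  define w where "w = \<alpha> *\<^sub>R a + \<beta> *\<^sub>R b + \<gamma> *\<^sub>R x"
  have n: "ip w w = - \<alpha>\<^sup>2 - \<beta>\<^sup>2 + \<gamma>\<^sup>2 * ip x x"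
    using a b ab xa xb ba by (simp add: w_def ip_simps power2_eq_square algebra_simps)
  have g: "\<gamma>\<^sup>2 * ip x x \<le> 0"
    using xx by (simp add: mult_nonneg_nonpos)
  have le: "ip w w \<le> 0"
    unfolding n using g zero_le_power2[of \<alpha>] zero_le_power2[of \<beta>] by linarith
  have w: "w = 0"
    using le by (intro zero_if_timelike_part_zero)
      (simp_all add: w_def \<alpha>_def \<beta>_def \<gamma>_def algebra_simps)
  then have "\<alpha>\<^sup>2 + \<beta>\<^sup>2 \<le> 0"
    using n g by (simp add: ip_simps)
  then have "\<alpha> = 0" "\<beta> = 0"
    by (simp_all add: sum_power2_le_zero_iff)
  then show False
    using w \<open>\<gamma> \<noteq> 0\<close> x by (simp add: w_def)
qed

section \<open>Reflections and the transitivity of \<open>O42\<close> on orthogonal frames\<close>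

definition reflection :: "real^6 \<Rightarrow> real^6^6"
  where "reflection n = matrix (\<lambda>x. x - (2 * ip n x / ip n n) *\<^sub>R n)"

lemma reflection_mult_vec: "reflection n *v x = x - (2 * ip n x / ip n n) *\<^sub>R n"
proof -
  have "linear (\<lambda>x. x - (2 * ip n x / ip n n) *\<^sub>R n)"
    by (simp add: linear_iff ip_simps algebra_simps add_divide_distrib)
  then show ?thesis
    by (simp add: reflection_def matrix_works)
qed

lemma reflection_in_O42:
  assumes "ip n n \<noteq> 0"
  shows "reflection n \<in> O42"
proof -
  have "ip (x - (2 * ip n x / ip n n) *\<^sub>R n) (y - (2 * ip n y / ip n n) *\<^sub>R n) = ip x y" for x y
    using assms by (simp add: ip_simps ip_commute[of x n] field_simps)
  then show ?thesis
    by (simp add: O42_def reflection_mult_vec)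
qed

lemma reflection_fix: "ip n c = 0 \<Longrightarrow> reflection n *v c = c"
  by (simp add: reflection_mult_vec)

text \<open>Equal square lengths give 2 (a - b, a) = |a - b|^2, so exactly a - b is subtracted from
  a.\<close>

lemma reflection_diff:
  assumes "ip a a = ip b b" "ip (a - b) (a - b) \<noteq> 0"
  shows "reflection (a - b) *v a = b"
proof -
  have "2 * ip (a - b) a = ip (a - b) (a - b)"
    using assms(1) by (simp add: ip_simps ip_commute[of b a])
  then show ?thesis
    using assms(2) by (simp add: reflection_mult_vec)
qed

text \<open>The reflection in a - b works unless a - b is null. In that case a + b is not null,
  since |a - b|^2 + |a + b|^2 = 4 |b|^2; the reflection in a + b sends a to -b, and the reflection
  in b corrects the sign. All mirrors are normal to vectors in the span of a and b, so vectors
  orthogonal to both stay fixed; this clause makes the step iterable along a frame.\<close>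

lemma O42_transitive:
  assumes "ip a a = ip b b" "ip b b \<noteq> 0"
  shows "\<exists>A\<in>O42. A *v a = b \<and> (\<forall>c. ip a c = 0 \<longrightarrow> ip b c = 0 \<longrightarrow> A *v c = c)"
proof (cases "ip (a - b) (a - b) = 0")
  case False
  then show ?thesis
    using reflection_diff[OF assms(1)] reflection_in_O42[of "a - b"] reflection_fix[of "a - b"]
    by (metis diff_zero ip.diff_left)
next
  case True
  have "ip (a + b) (a + b) \<noteq> 0"
    using True assms by (auto simp: ip_simps ip_commute[of b a])
  then have ab: "reflection (a + b) *v a = - b" "reflection (a + b) \<in> O42"
    using reflection_diff[of a "- b"] assms(1) by (simp_all add: ip_simps reflection_in_O42)
  have b: "reflection b *v (- b) = b"
  proof -
    have "2 * ip b (- b) / ip b b = - 2"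
      using assms(2) by (simp add: ip_simps)
    then have "reflection b *v (- b) = - b - (- 2) *\<^sub>R b"
      by (simp only: reflection_mult_vec)
    also have "\<dots> = - b + (b + b)"
      by (simp only: scaleR_minus_left scaleR_2 diff_minus_eq_add)
    finally show ?thesis by simp
  qed
  show ?thesis
  proof (intro bexI conjI allI impI)
    show "reflection b ** reflection (a + b) \<in> O42"
      using O42_mult[OF reflection_in_O42[OF assms(2)] ab(2)] .
    show "(reflection b ** reflection (a + b)) *v a = b"
      unfolding matrix_vector_mul_assoc[symmetric] ab(1) b ..
    fix c assume "ip a c = 0" "ip b c = 0"
    then show "(reflection b ** reflection (a + b)) *v c = c"
      unfolding matrix_vector_mul_assoc[symmetric] by (simp add: reflection_fix ip.add_left)
  qed
qed

text \<open>One vector is placed at a time: a vector already in place is orthogonal both to the next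
  one and to its target, so the next isometry fixes it.\<close>

lemma O42_frame_transitive:
  assumes "ip a1 a1 = ip b1 b1" "ip a2 a2 = ip b2 b2" "ip a3 a3 = ip b3 b3"
    and "ip b1 b1 \<noteq> 0" "ip b2 b2 \<noteq> 0" "ip b3 b3 \<noteq> 0"
    and "ip a1 a2 = 0" "ip a1 a3 = 0" "ip a2 a3 = 0"
    and "ip b1 b2 = 0" "ip b1 b3 = 0" "ip b2 b3 = 0"
  shows "\<exists>A\<in>O42. A *v a1 = b1 \<and> A *v a2 = b2 \<and> A *v a3 = b3"
proof -
  obtain A where A: "A \<in> O42" "A *v a1 = b1"
    using O42_transitive[OF assms(1,4)] by blast
  have A0: "ip b1 (A *v a2) = 0" "ip b1 (A *v a3) = 0" "ip (A *v a2) (A *v a3) = 0"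
    using assms(7-9) O42_ip[OF A(1), of a1 a2] O42_ip[OF A(1), of a1 a3] O42_ip[OF A(1), of a2 a3]
    by (simp_all add: A(2))
  obtain B where B: "B \<in> O42" "B *v (A *v a2) = b2"
    "\<And>c. ip (A *v a2) c = 0 \<Longrightarrow> ip b2 c = 0 \<Longrightarrow> B *v c = c"
    using O42_transitive[OF trans[OF O42_ip[OF A(1)] assms(2)] assms(5)] by blast
  have B1: "B *v b1 = b1"
    by (rule B(3); subst ip_commute, rule A0(1) assms(10))
  have B0: "ip b1 (B *v (A *v a3)) = 0" "ip b2 (B *v (A *v a3)) = 0"
    using A0(2,3) O42_ip[OF B(1), of b1 "A *v a3"] O42_ip[OF B(1), of "A *v a2" "A *v a3"]
    by (simp_all add: B1 B(2))
  obtain C where C: "C \<in> O42" "C *v (B *v (A *v a3)) = b3"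
    "\<And>c. ip (B *v (A *v a3)) c = 0 \<Longrightarrow> ip b3 c = 0 \<Longrightarrow> C *v c = c"
    using O42_transitive[OF trans[OF O42_ip[OF B(1)] trans[OF O42_ip[OF A(1)] assms(3)]] assms(6)]
    by blast
  have C12: "C *v b1 = b1" "C *v b2 = b2"
    by (rule C(3); subst ip_commute, rule B0 assms(11,12))+
  show ?thesis
  proof (intro bexI conjI)
    show "C ** (B ** A) \<in> O42"
      using A(1) B(1) C(1) by (intro O42_mult)
  qed (simp_all only: matrix_vector_mul_assoc[symmetric] A(2) B(2) B1 C(2) C12)
qed

section \<open>Curvature of the metrics of flat fronts\<close>

lemma dirderiv_mult:
  fixes f g :: "'a::real_normed_vector \<Rightarrow> real"
  assumes "f differentiable (at x)" "g differentiable (at x)"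
  shows "dirderiv (\<lambda>y. f y * g y) x X = dirderiv f x X * g x + f x * dirderiv g x X"
  by (rule dirderiv_eqI[THEN trans, OF has_derivative_mult[OF assms[THEN dirderiv_has_derivative]]])
    simp

lemma dirderiv_divide:
  fixes f g :: "'a::real_normed_vector \<Rightarrow> real"
  assumes "f differentiable (at x)" "g differentiable (at x)" "g x \<noteq> 0"
  shows "dirderiv (\<lambda>y. f y / g y) x X = (dirderiv f x X * g x - f x * dirderiv g x X) / (g x)\<^sup>2"
  by (rule dirderiv_eqI[THEN trans, OF has_derivative_divide'[OF assms(1,2)[THEN dirderiv_has_derivative]
          assms(3)]]) (simp add: power2_eq_square)

lemma dirderiv_minus:
  assumes "f differentiable (at x)"
  shows "dirderiv (\<lambda>y. - f y) x X = - dirderiv f x X"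
  by (rule dirderiv_eqI[OF has_derivative_minus[OF dirderiv_has_derivative[OF assms]]])

lemma matrix_inv_diagonal:
  fixes A :: "real^2^2"
  assumes "A $ 1 $ 2 = 0" "A $ 2 $ 1 = 0" "A $ 1 $ 1 \<noteq> 0" "A $ 2 $ 2 \<noteq> 0"
  shows "matrix_inv A $ 1 $ 1 = 1 / A $ 1 $ 1" "matrix_inv A $ 2 $ 2 = 1 / A $ 2 $ 2"
    "matrix_inv A $ 1 $ 2 = 0" "matrix_inv A $ 2 $ 1 = 0"
proof -
  define B :: "real^2^2" where "B = vector [vector [1 / A $ 1 $ 1, 0], vector [0, 1 / A $ 2 $ 2]]"
  have AB: "A ** B = mat 1" and BA: "B ** A = mat 1"
    using assms by (simp_all add: vec_eq_iff forall_2 B_def matrix_matrix_mult_def sum_2 mat_def)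
  have "A ** matrix_inv A = mat 1 \<and> matrix_inv A ** A = mat 1"
    unfolding matrix_inv_def by (rule someI[of _ B]) (simp add: AB BA)
  then have "matrix_inv A = B"
    using AB by (metis matrix_mul_assoc matrix_mul_lid matrix_mul_rid)
  then show "matrix_inv A $ 1 $ 1 = 1 / A $ 1 $ 1" "matrix_inv A $ 2 $ 2 = 1 / A $ 2 $ 2"
    "matrix_inv A $ 1 $ 2 = 0" "matrix_inv A $ 2 $ 1 = 0"
    by (simp_all add: B_def)
qed

text \<open>For $a = \cosh(\varphi - r)$, $b = \sinh(\varphi - r)$, and with the two exchanged, the metric
  $E a^2 du^2 + G b^2 dv^2$ with $E = E(u)$ and $G = G(v)$ is flat if and only if this expression,
  which does not involve \<open>r\<close>, vanishes.\<close>

definition flatness_defect ::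
    "(real^2 \<Rightarrow> real) \<Rightarrow> (real^2 \<Rightarrow> real) \<Rightarrow> (real^2 \<Rightarrow> real) \<Rightarrow> real^2 \<Rightarrow> real"
  where "flatness_defect E G \<phi> x =
    G x / E x * (pderivative 1 (pderivative 1 \<phi>) x - pderivative 1 \<phi> x * pderivative 1 E x / (2 * E x))
    + pderivative 2 (pderivative 2 \<phi>) x - pderivative 2 \<phi> x * pderivative 2 G x / (2 * G x)"

text \<open>Homogeneity of degree 0 in the pair \<open>E\<close>, \<open>G\<close> disposes of the
  constant factor that the deformation puts on the metrics.\<close>

lemma flatness_defect_scale:
  assumes "k \<noteq> 0" "E differentiable (at x)" "G differentiable (at x)"
  shows "flatness_defect (\<lambda>y. k * E y) (\<lambda>y. k * G y) \<phi> x = flatness_defect E G \<phi> x"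
proof -
  have d: "dirderiv (\<lambda>y. k * E y) x X = k * dirderiv E x X"
    "dirderiv (\<lambda>y. k * G y) x X = k * dirderiv G x X" for X
    using assms by (simp_all add: dirderiv_mult)
  show ?thesis
    using assms(1) by (simp add: flatness_defect_def d)
qed

text \<open>The relations da = b d\<phi> and db = a d\<phi> are symmetric in \<open>a\<close> and
  \<open>b\<close>, so a single computation treats both assignments of cosh and sinh. The hypotheses
  are made on a neighbourhood because Christoffel symbols are differentiated at
  \<open>x\<close>.\<close>

lemma gauss_curvature_eq_flatness_defect:
  assumes V: "open V" "x \<in> V"
    and g: "\<And>y. y \<in> V \<Longrightarrow> g y $ 1 $ 1 = E y * (a y)\<^sup>2" "\<And>y. y \<in> V \<Longrightarrow> g y $ 2 $ 2 = G y * (b y)\<^sup>2"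
      "\<And>y. y \<in> V \<Longrightarrow> g y $ 1 $ 2 = 0" "\<And>y. y \<in> V \<Longrightarrow> g y $ 2 $ 1 = 0"
    and nz: "\<And>y. y \<in> V \<Longrightarrow> E y \<noteq> 0" "\<And>y. y \<in> V \<Longrightarrow> G y \<noteq> 0"
      "\<And>y. y \<in> V \<Longrightarrow> a y \<noteq> 0" "\<And>y. y \<in> V \<Longrightarrow> b y \<noteq> 0"
    and E: "\<And>y. y \<in> V \<Longrightarrow> E differentiable (at y)" "\<And>y. y \<in> V \<Longrightarrow> pderivative 2 E y = 0"
    and G: "\<And>y. y \<in> V \<Longrightarrow> G differentiable (at y)" "\<And>y. y \<in> V \<Longrightarrow> pderivative 1 G y = 0"
    and a: "\<And>y. y \<in> V \<Longrightarrow> (a has_derivative (\<lambda>X. dirderiv \<phi> y X * b y)) (at y)"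
    and b: "\<And>y. y \<in> V \<Longrightarrow> (b has_derivative (\<lambda>X. dirderiv \<phi> y X * a y)) (at y)"
    and \<phi>: "\<And>i. pderivative i \<phi> differentiable (at x)"
  shows "gauss_curvature g x = - flatness_defect E G \<phi> x / (G x * a x * b x)"
proof -
  have ad: "a differentiable (at y)" "dirderiv a y X = dirderiv \<phi> y X * b y"
    and bd: "b differentiable (at y)" "dirderiv b y X = dirderiv \<phi> y X * a y" if "y \<in> V" for y X
    using a[OF that] b[OF that] by (auto simp: differentiable_def dirderiv_eqI)
  have g11: "dirderiv (\<lambda>z. g z $ 1 $ 1) y X
      = dirderiv E y X * (a y)\<^sup>2 + 2 * E y * a y * b y * dirderiv \<phi> y X" if "y \<in> V" for y X
  proof -
    have "dirderiv (\<lambda>z. g z $ 1 $ 1) y X = dirderiv (\<lambda>z. E z * (a z * a z)) y X"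
      using g(1) by (intro dirderiv_cong[OF V(1) that]) (simp add: power2_eq_square)
    then show ?thesis
      using that by (simp add: dirderiv_mult E ad power2_eq_square algebra_simps)
  qed
  have g22: "dirderiv (\<lambda>z. g z $ 2 $ 2) y X
      = dirderiv G y X * (b y)\<^sup>2 + 2 * G y * a y * b y * dirderiv \<phi> y X" if "y \<in> V" for y X
  proof -
    have "dirderiv (\<lambda>z. g z $ 2 $ 2) y X = dirderiv (\<lambda>z. G z * (b z * b z)) y X"
      using g(2) by (intro dirderiv_cong[OF V(1) that]) (simp add: power2_eq_square)
    then show ?thesis
      using that by (simp add: dirderiv_mult G bd power2_eq_square algebra_simps)
  qed
  have g12: "dirderiv (\<lambda>z. g z $ 1 $ 2) y X = 0" "dirderiv (\<lambda>z. g z $ 2 $ 1) y X = 0"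
    if "y \<in> V" for y X
    using g(3,4) by (auto intro: dirderiv_const_on[OF V(1) that])
  have inv: "matrix_inv (g y) $ 1 $ 1 = 1 / (E y * (a y)\<^sup>2)" "matrix_inv (g y) $ 2 $ 2 = 1 / (G y * (b y)\<^sup>2)"
    "matrix_inv (g y) $ 1 $ 2 = 0" "matrix_inv (g y) $ 2 $ 1 = 0" if "y \<in> V" for y
    using that by (simp_all add: matrix_inv_diagonal g nz)
  note christoffel = christoffel_def sum_2 inv g11 g22 g12 E(2) G(2)
  have c1_11: "christoffel g 1 1 1 y = pderivative 1 E y / (2 * E y) + pderivative 1 \<phi> y * (b y / a y)"
    if "y \<in> V" for y
    using that nz[OF that] by (simp add: christoffel) (simp add: field_simps power2_eq_square)
  have c1_12: "christoffel g 1 1 2 y = pderivative 2 \<phi> y * (b y / a y)"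
      "christoffel g 1 2 1 y = pderivative 2 \<phi> y * (b y / a y)" if "y \<in> V" for y
    using that nz[OF that] by (simp_all add: christoffel) (simp_all add: field_simps power2_eq_square)
  have c1_22: "christoffel g 1 2 2 y = - (G y / E y * (pderivative 1 \<phi> y * (b y / a y)))"
    if "y \<in> V" for y
    using that nz[OF that] by (simp add: christoffel) (simp add: field_simps power2_eq_square)
  have c2_12: "christoffel g 2 1 2 y = pderivative 1 \<phi> y * (a y / b y)"
    "christoffel g 2 2 1 y = pderivative 1 \<phi> y * (a y / b y)" if "y \<in> V" for y
    using that nz[OF that] by (simp_all add: christoffel) (simp_all add: field_simps power2_eq_square)
  have c2_22: "christoffel g 2 2 2 y = pderivative 2 G y / (2 * G y) + pderivative 2 \<phi> y * (a y / b y)"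
    if "y \<in> V" for y
    using that nz[OF that] by (simp add: christoffel) (simp add: field_simps power2_eq_square)
  have dba: "(\<lambda>y. b y / a y) differentiable (at x)"
    using V(2) ad bd nz by (intro differentiable_divide) auto
  \<comment> \<open>By da = b d\<phi> and db = a d\<phi>, d(b/a) = (a^2 - b^2)/a^2 d\<phi>.\<close>
  have ba: "dirderiv (\<lambda>y. b y / a y) x X = dirderiv \<phi> x X * (1 - (b x / a x)\<^sup>2)" for X
    using V(2) nz(3)[OF V(2)]
    by (simp add: dirderiv_divide ad bd) (simp add: field_simps power2_eq_square)
  have dGE: "(\<lambda>y. G y / E y) differentiable (at x)"
    using V(2) E G nz by (intro differentiable_divide) auto
  have GE: "pderivative 1 (\<lambda>y. G y / E y) x = - G x * pderivative 1 E x / (E x)\<^sup>2"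
    using V(2) nz by (simp add: dirderiv_divide E G)
  have \<phi>ba: "dirderiv (\<lambda>y. pderivative i \<phi> y * (b y / a y)) x X =
      dirderiv (pderivative i \<phi>) x X * (b x / a x) + pderivative i \<phi> x * (dirderiv \<phi> x X * (1 - (b x / a x)\<^sup>2))"
    for i X
    unfolding ba[symmetric] by (rule dirderiv_mult[OF \<phi> dba])
  have d12: "pderivative 2 (christoffel g 1 1 2) x = pderivative 2 (pderivative 2 \<phi>) x * (b x / a x)
      + (pderivative 2 \<phi> x)\<^sup>2 * (1 - (b x / a x)\<^sup>2)"
  proof -
    have "pderivative 2 (christoffel g 1 1 2) x = pderivative 2 (\<lambda>y. pderivative 2 \<phi> y * (b y / a y)) x"
      using c1_12 by (intro dirderiv_cong[OF V])
    then show ?thesis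
      unfolding \<phi>ba by (simp add: power2_eq_square)
  qed
  have d22: "pderivative 1 (christoffel g 1 2 2) x =
      G x * pderivative 1 E x / (E x)\<^sup>2 * (pderivative 1 \<phi> x * (b x / a x)) - G x / E x *
      (pderivative 1 (pderivative 1 \<phi>) x * (b x / a x) + (pderivative 1 \<phi> x)\<^sup>2 * (1 - (b x / a x)\<^sup>2))"
  proof -
    have "pderivative 1 (christoffel g 1 2 2) x
        = pderivative 1 (\<lambda>y. - (G y / E y * (pderivative 1 \<phi> y * (b y / a y)))) x"
      using c1_22 by (intro dirderiv_cong[OF V])
    also have "\<dots> = - pderivative 1 (\<lambda>y. G y / E y * (pderivative 1 \<phi> y * (b y / a y))) x"
      by (intro dirderiv_minus differentiable_mult dGE dba \<phi>)
    also have "pderivative 1 (\<lambda>y. G y / E y * (pderivative 1 \<phi> y * (b y / a y))) x =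
      pderivative 1 (\<lambda>y. G y / E y) x * (pderivative 1 \<phi> x * (b x / a x)) +
      G x / E x * pderivative 1 (\<lambda>y. pderivative 1 \<phi> y * (b y / a y)) x"
      by (intro dirderiv_mult differentiable_mult dGE dba \<phi>)
    also have "pderivative 1 (\<lambda>y. pderivative 1 \<phi> y * (b y / a y)) x =
      pderivative 1 (pderivative 1 \<phi>) x * (b x / a x) + (pderivative 1 \<phi> x)\<^sup>2 * (1 - (b x / a x)\<^sup>2)"
      unfolding \<phi>ba by (simp add: power2_eq_square)
    finally show ?thesis
      unfolding GE by (simp add: algebra_simps)
  qed
  have R: "riemann g 1 1 2 2 x = - flatness_defect E G \<phi> x * (b x / a x)"
    unfolding riemann_def sum_2 d12 d22 c1_11[OF V(2)] c1_12[OF V(2)] c1_22[OF V(2)] c2_12[OF V(2)]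
      c2_22[OF V(2)] flatness_defect_def
    using nz[OF V(2)] by (simp add: divide_simps) (simp add: algebra_simps power2_eq_square)
  \<comment> \<open>The metric is diagonal, so only the component \<open>l\<close> = 1 contributes,
    and its factor cancels against the determinant.\<close>
  have "gauss_curvature g x = riemann g 1 1 2 2 x / (G x * (b x)\<^sup>2)"
    unfolding gauss_curvature_def sum_2 det_2 using V(2) nz[OF V(2)] by (simp add: g)
  then show ?thesis
    using nz[OF V(2)] unfolding R by (simp add: field_simps power2_eq_square)
qed

section \<open>Legendre lifts\<close>

lemma ip_const_dirderiv:
  assumes "open U" "smooth_map U g" "smooth_map U h" "x \<in> U" "\<And>y. y \<in> U \<Longrightarrow> ip (g y) (h y) = c"
  shows "ip (dirderiv g x X) (h x) + ip (g x) (dirderiv h x X) = 0"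
proof -
  have "((\<lambda>y. ip (g y) (h y)) has_derivative
      (\<lambda>X. ip (g x) (dirderiv h x X) + ip (dirderiv g x X) (h x))) (at x)"
    using assms by (intro ip.FDERIV smooth_map_has_derivative)
  from dirderiv_eqI[OF this] dirderiv_const_on[OF assms(1,4), of "\<lambda>y. ip (g y) (h y)" c] assms(5)
  show ?thesis by (metis add.commute)
qed

text \<open>This is a front without the choice of sheet y_0 > 0 and without regularity. It is
  instantiated for the given pair and again for the deformed one, whose sheet is determined only
  afterwards.\<close>

locale legendre_pair =
  fixes \<pp> \<qq> :: "real^6" and U :: "(real^2) set" and \<ff> \<tt> :: "real^2 \<Rightarrow> real^6"
  assumes pq: "ip \<pp> \<pp> = -1" "ip \<qq> \<qq> = 1" "ip \<pp> \<qq> = 0"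
    and open_U: "open U"
    and smooth: "smooth_map U \<ff>" "smooth_map U \<tt>"
    and normalized: "\<And>x. x \<in> U \<Longrightarrow> ip (\<ff> x) (\<ff> x) = -1" "\<And>x. x \<in> U \<Longrightarrow> ip (\<tt> x) (\<tt> x) = 1"
    and orth: "\<And>x. x \<in> U \<Longrightarrow> ip (\<tt> x) (\<ff> x) = 0"
      "\<And>x. x \<in> U \<Longrightarrow> ip (\<ff> x) \<pp> = 0" "\<And>x. x \<in> U \<Longrightarrow> ip (\<ff> x) \<qq> = 0"
      "\<And>x. x \<in> U \<Longrightarrow> ip (\<tt> x) \<pp> = 0" "\<And>x. x \<in> U \<Longrightarrow> ip (\<tt> x) \<qq> = 0"
    and normal: "\<And>x X. x \<in> U \<Longrightarrow> ip (\<tt> x) (dirderiv \<ff> x X) = 0"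
begin

lemma deriv:
  assumes "x \<in> U"
  shows "(\<ff> has_derivative dirderiv \<ff> x) (at x)" "(\<tt> has_derivative dirderiv \<tt> x) (at x)"
  using smooth assms by (auto intro: smooth_map_has_derivative)

lemma ip_deriv:
  assumes "x \<in> U"
  shows "ip (dirderiv \<ff> x X) \<pp> = 0" "ip (dirderiv \<ff> x X) \<qq> = 0"
    "ip (dirderiv \<tt> x X) \<pp> = 0" "ip (dirderiv \<tt> x X) \<qq> = 0"
    "ip (dirderiv \<ff> x X) (\<ff> x) = 0" "ip (dirderiv \<tt> x X) (\<tt> x) = 0"
    "ip (dirderiv \<tt> x X) (\<ff> x) = 0" "ip (dirderiv \<ff> x X) (\<tt> x) = 0"
  using ip_const_dirderiv[OF open_U smooth(1) smooth_map_const assms orth(2), of X]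
    ip_const_dirderiv[OF open_U smooth(1) smooth_map_const assms orth(3), of X]
    ip_const_dirderiv[OF open_U smooth(2) smooth_map_const assms orth(4), of X]
    ip_const_dirderiv[OF open_U smooth(2) smooth_map_const assms orth(5), of X]
    ip_const_dirderiv[OF open_U smooth(1) smooth(1) assms normalized(1), of X]
    ip_const_dirderiv[OF open_U smooth(2) smooth(2) assms normalized(2), of X]
    ip_const_dirderiv[OF open_U smooth(2) smooth(1) assms orth(1), of X]
    normal[OF assms, of X] ip_commute[of "\<tt> x" "dirderiv \<ff> x X"] ip_commute[of "\<ff> x" "dirderiv \<ff> x X"] ip_commute[of "\<tt> x" "dirderiv \<tt> x X"]
  by (simp_all add: ip_simps)

text \<open>Fixed instances of symmetry turn each product into the order in which its value is known
  to the simplifier.\<close>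

lemmas ip_right_to_left = ip_commute[of \<qq> \<pp>] ip_commute[of \<pp> "\<ff> x" for x]
  ip_commute[of \<pp> "\<tt> x" for x] ip_commute[of \<qq> "\<ff> x" for x] ip_commute[of \<qq> "\<tt> x" for x]
  ip_commute[of "\<ff> x" "\<tt> y" for x y]
  ip_commute[of \<pp> "dirderiv \<ff> x X" for x X] ip_commute[of \<pp> "dirderiv \<tt> x X" for x X]
  ip_commute[of \<qq> "dirderiv \<ff> x X" for x X] ip_commute[of \<qq> "dirderiv \<tt> x X" for x X]
  ip_commute[of "\<ff> y" "dirderiv \<ff> x X" for x y X] ip_commute[of "\<ff> y" "dirderiv \<tt> x X" for x y X]
  ip_commute[of "\<tt> y" "dirderiv \<tt> x X" for x y X]

lemmas ips = ip_simps pq normalized orth normal ip_deriv ip_right_to_left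

lemma lift_isotropic:
  assumes "x \<in> U"
  shows "ip (\<qq> + \<ff> x) (\<qq> + \<ff> x) = 0" "ip (\<pp> + \<tt> x) (\<pp> + \<tt> x) = 0"
    "ip (\<qq> + \<ff> x) (\<pp> + \<tt> x) = 0" "ip (\<pp> + \<tt> x) (\<qq> + \<ff> x) = 0"
  using assms by (simp_all add: ips)

text \<open>Since \<ff> and \<tt> are orthogonal to \<pp> and \<qq>, pairing with \<qq> and \<pp>
  reads off the coefficients, with a minus sign from |\<pp>|^2 = -1. Membership thus becomes an
  equation that can be differentiated.\<close>

lemma mem_lift_iff:
  assumes "x \<in> U"
  shows "y \<in> legendre_lift \<pp> \<qq> \<ff> \<tt> x \<longleftrightarrow> y = ip y \<qq> *\<^sub>R (\<qq> + \<ff> x) - ip y \<pp> *\<^sub>R (\<pp> + \<tt> x)"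
proof
  assume "y \<in> legendre_lift \<pp> \<qq> \<ff> \<tt> x"
  then obtain \<alpha> \<beta> where y: "y = \<alpha> *\<^sub>R (\<qq> + \<ff> x) + \<beta> *\<^sub>R (\<pp> + \<tt> x)"
    unfolding legendre_lift_def span_breakdown_eq by (auto simp: algebra_simps)
  then have "ip y \<qq> = \<alpha>" "ip y \<pp> = - \<beta>"
    using assms by (simp_all add: ips)
  with y show "y = ip y \<qq> *\<^sub>R (\<qq> + \<ff> x) - ip y \<pp> *\<^sub>R (\<pp> + \<tt> x)"
    by simp
next
  assume y: "y = ip y \<qq> *\<^sub>R (\<qq> + \<ff> x) - ip y \<pp> *\<^sub>R (\<pp> + \<tt> x)"
  have "\<alpha> *\<^sub>R (\<qq> + \<ff> x) - \<beta> *\<^sub>R (\<pp> + \<tt> x) \<in> legendre_lift \<pp> \<qq> \<ff> \<tt> x" for \<alpha> \<beta>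
    unfolding legendre_lift_def by (intro span_diff span_scale span_base) auto
  with y show "y \<in> legendre_lift \<pp> \<qq> \<ff> \<tt> x"
    by metis
qed

lemma null_plane_lift:
  assumes "x \<in> U"
  shows "null_plane (legendre_lift \<pp> \<qq> \<ff> \<tt> x)"
proof -
  have "independent {\<qq> + \<ff> x, \<pp> + \<tt> x}"
  proof (rule independent_insertI)
    show "\<qq> + \<ff> x \<notin> span {\<pp> + \<tt> x}"
    proof
      assume "\<qq> + \<ff> x \<in> span {\<pp> + \<tt> x}"
      then obtain k where "\<qq> + \<ff> x = k *\<^sub>R (\<pp> + \<tt> x)"
        by (auto simp: span_singleton)
      then have "ip (\<qq> + \<ff> x) \<qq> = ip (k *\<^sub>R (\<pp> + \<tt> x)) \<qq>" by simp
      then show False using assms by (simp add: ips)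
    qed
    have "ip (\<pp> + \<tt> x) \<pp> \<noteq> 0" using assms by (simp add: ips)
    then have "\<pp> + \<tt> x \<noteq> 0" by (metis ip.zero_left)
    then show "independent {\<pp> + \<tt> x}" by simp
  qed
  moreover have "\<qq> + \<ff> x \<noteq> \<pp> + \<tt> x"
  proof
    assume "\<qq> + \<ff> x = \<pp> + \<tt> x"
    then have "ip (\<qq> + \<ff> x) \<qq> = ip (\<pp> + \<tt> x) \<qq>" by simp
    then show False using assms by (simp add: ips)
  qed
  ultimately have "dim (span {\<qq> + \<ff> x, \<pp> + \<tt> x}) = 2"
    by (simp add: dim_eq_card_independent)
  moreover have "ip a b = 0" if "a \<in> legendre_lift \<pp> \<qq> \<ff> \<tt> x" "b \<in> legendre_lift \<pp> \<qq> \<ff> \<tt> x" for a b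
  proof -
    have "ip a b = ip (ip a \<qq> *\<^sub>R (\<qq> + \<ff> x) - ip a \<pp> *\<^sub>R (\<pp> + \<tt> x)) (ip b \<qq> *\<^sub>R (\<qq> + \<ff> x) - ip b \<pp> *\<^sub>R (\<pp> + \<tt> x))"
      using that unfolding mem_lift_iff[OF assms] by simp
    also have "\<dots> = 0"
      by (simp only: ip.diff_left ip.diff_right ip.scaleR_left ip.scaleR_right lift_isotropic[OF assms])
        simp
    finally show ?thesis .
  qed
  ultimately show ?thesis
    by (simp add: null_plane_def legendre_lift_def)
qed

lemma smooth_lift: "smooth_map U (\<lambda>x. \<qq> + \<ff> x)" "smooth_map U (\<lambda>x. \<pp> + \<tt> x)"
  using smooth by (auto intro: smooth_map_add[OF open_U smooth_map_const])

lemma dirderiv_lift: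
  assumes "x \<in> U"
  shows "dirderiv (\<lambda>x. \<qq> + \<ff> x) x X = dirderiv \<ff> x X" "dirderiv (\<lambda>x. \<pp> + \<tt> x) x X = dirderiv \<tt> x X"
  using deriv[OF assms] by (auto intro!: dirderiv_eqI derivative_eq_intros)

lemma section_dirderiv:
  assumes s: "is_section U (legendre_lift \<pp> \<qq> \<ff> \<tt>) s" and x: "x \<in> U"
  shows "dirderiv s x X = ip (s x) \<qq> *\<^sub>R dirderiv \<ff> x X - ip (s x) \<pp> *\<^sub>R dirderiv \<tt> x X
    + ip (dirderiv s x X) \<qq> *\<^sub>R (\<qq> + \<ff> x) - ip (dirderiv s x X) \<pp> *\<^sub>R (\<pp> + \<tt> x)"
proof -
  have ds: "(s has_derivative dirderiv s x) (at x)"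
    using s x by (auto simp: is_section_def intro: smooth_map_has_derivative)
  have "dirderiv s x X = dirderiv (\<lambda>y. ip (s y) \<qq> *\<^sub>R (\<qq> + \<ff> y) - ip (s y) \<pp> *\<^sub>R (\<pp> + \<tt> y)) x X"
    using s mem_lift_iff by (intro dirderiv_cong[OF open_U x]) (auto simp: is_section_def)
  also have "\<dots> = ip (s x) \<qq> *\<^sub>R dirderiv \<ff> x X - ip (s x) \<pp> *\<^sub>R dirderiv \<tt> x X
    + ip (dirderiv s x X) \<qq> *\<^sub>R (\<qq> + \<ff> x) - ip (dirderiv s x X) \<pp> *\<^sub>R (\<pp> + \<tt> x)"
    by (rule dirderiv_eqI) (auto intro!: derivative_eq_intros ip.FDERIV ds deriv[OF x]
        simp: ip_simps algebra_simps)
  finally show ?thesis .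
qed

text \<open>The contact condition is automatic from (\<tt>, d\<ff>) = 0. For regularity the two
  spanning sections suffice as tests: their derivatives d\<ff> and d\<tt> are orthogonal to \<pp>
  and \<qq>, so they lie in the lift only when they vanish.\<close>

lemma legendre_map_iff:
  "legendre_map U (legendre_lift \<pp> \<qq> \<ff> \<tt>) \<longleftrightarrow>
    (\<forall>x\<in>U. \<forall>X. dirderiv \<ff> x X = 0 \<longrightarrow> dirderiv \<tt> x X = 0 \<longrightarrow> X = 0)"
proof -
  have "smooth_null_plane_map U (legendre_lift \<pp> \<qq> \<ff> \<tt>)"
    unfolding smooth_null_plane_map_def
  proof (intro conjI ballI)
    fix x assume x: "x \<in> U"
    show "\<exists>V a b. open V \<and> x \<in> V \<and> V \<subseteq> U \<and> smooth_map V a \<and> smooth_map V b \<and>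
       (\<forall>y\<in>V. legendre_lift \<pp> \<qq> \<ff> \<tt> y = span {a y, b y})"
      using x open_U smooth_lift
      by (intro exI[of _ U] exI[of _ "\<lambda>x. \<qq> + \<ff> x"] exI[of _ "\<lambda>x. \<pp> + \<tt> x"])
        (simp add: legendre_lift_def)
  qed (rule null_plane_lift)
  moreover have "ip (dirderiv s x X) (s' x) = 0"
    if s: "is_section U (legendre_lift \<pp> \<qq> \<ff> \<tt>) s" and s': "is_section U (legendre_lift \<pp> \<qq> \<ff> \<tt>) s'"
      and x: "x \<in> U" for s s' x X
  proof -
    have "s' x = ip (s' x) \<qq> *\<^sub>R (\<qq> + \<ff> x) - ip (s' x) \<pp> *\<^sub>R (\<pp> + \<tt> x)"
      using s' x by (auto simp: is_section_def mem_lift_iff)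
    moreover have "ip (dirderiv s x X) (\<qq> + \<ff> x) = 0" "ip (dirderiv s x X) (\<pp> + \<tt> x) = 0"
      by (subst section_dirderiv[OF s x];
          simp only: ip.add_left[of _ _ "\<qq> + \<ff> x"] ip.diff_left ip.scaleR_left lift_isotropic[OF x]
            ip.add_left[of _ _ "\<pp> + \<tt> x"]; simp add: ips x)+
    ultimately show ?thesis
      by (metis ip.diff_right ip.scaleR_right diff_zero scaleR_zero_right)
  qed
  moreover have "(\<forall>s. is_section U (legendre_lift \<pp> \<qq> \<ff> \<tt>) s \<longrightarrow>
      dirderiv s x X \<in> legendre_lift \<pp> \<qq> \<ff> \<tt> x) \<longleftrightarrow> dirderiv \<ff> x X = 0 \<and> dirderiv \<tt> x X = 0"
    if x: "x \<in> U" for x X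
  proof (intro iffI allI impI)
    assume *: "\<forall>s. is_section U (legendre_lift \<pp> \<qq> \<ff> \<tt>) s \<longrightarrow>
      dirderiv s x X \<in> legendre_lift \<pp> \<qq> \<ff> \<tt> x"
    have "is_section U (legendre_lift \<pp> \<qq> \<ff> \<tt>) (\<lambda>x. \<qq> + \<ff> x)"
      "is_section U (legendre_lift \<pp> \<qq> \<ff> \<tt>) (\<lambda>x. \<pp> + \<tt> x)"
      using smooth_lift by (auto simp: is_section_def legendre_lift_def span_base)
    then have "dirderiv \<ff> x X \<in> legendre_lift \<pp> \<qq> \<ff> \<tt> x" "dirderiv \<tt> x X \<in> legendre_lift \<pp> \<qq> \<ff> \<tt> x"
      using * dirderiv_lift[OF x] by metis+
    then show "dirderiv \<ff> x X = 0 \<and> dirderiv \<tt> x X = 0"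
      unfolding mem_lift_iff[OF x] by (simp add: ips x)
  next
    fix s assume "dirderiv \<ff> x X = 0 \<and> dirderiv \<tt> x X = 0"
      and s: "is_section U (legendre_lift \<pp> \<qq> \<ff> \<tt>) s"
    then show "dirderiv s x X \<in> legendre_lift \<pp> \<qq> \<ff> \<tt> x"
      using section_dirderiv[OF s x, of X] by (simp add: mem_lift_iff[OF x])
  qed
  ultimately show ?thesis
    unfolding legendre_map_def by auto
qed

end

lemma front_iff:
  assumes "adapted_frame \<pp> \<qq> \<ee>" "open U"
  shows "front \<pp> \<qq> \<ee> U \<ff> \<tt> \<longleftrightarrow> legendre_pair \<pp> \<qq> U \<ff> \<tt> \<and> (\<forall>x\<in>U. ip (\<ff> x) \<ee> < 0) \<and>
    (\<forall>x\<in>U. \<forall>X. dirderiv \<ff> x X = 0 \<longrightarrow> dirderiv \<tt> x X = 0 \<longrightarrow> X = 0)"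
proof (cases "legendre_pair \<pp> \<qq> U \<ff> \<tt>")
  case True
  then interpret legendre_pair \<pp> \<qq> U \<ff> \<tt> .
  have "(\<forall>x\<in>U. \<ff> x \<in> H3 \<pp> \<qq> \<ee> \<and> \<tt> x \<in> S21 \<pp> \<qq> \<and> ip (\<tt> x) (\<ff> x) = 0 \<and>
       (\<forall>X. ip (\<tt> x) (dirderiv \<ff> x X) = 0)) \<longleftrightarrow> (\<forall>x\<in>U. ip (\<ff> x) \<ee> < 0)"
    using normalized orth normal by (auto simp: H3_def S21_def R31_def)
  then show ?thesis
    using True smooth by (simp add: front_def legendre_map_iff)
next
  case False
  moreover have "legendre_pair \<pp> \<qq> U \<ff> \<tt>" if "front \<pp> \<qq> \<ee> U \<ff> \<tt>"
    using that assms
    by unfold_locales (auto simp: front_def H3_def S21_def R31_def adapted_frame_def)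
  ultimately show ?thesis by auto
qed

section \<open>Curvature line coordinates\<close>

lemma open_nonzero_set:
  fixes h :: "'a::topological_space \<Rightarrow> real"
  assumes "open U" "continuous_on U h"
  shows "open {y \<in> U. h y \<noteq> 0}"
proof -
  have "open (U \<inter> h -` (- {0}))"
    using assms by (intro continuous_open_preimage) auto
  then show ?thesis
    by (simp add: Int_def vimage_def Compl_eq)
qed

text \<open>The hyperbolic rotation with rows (cosh r, sinh r) and (sinh r, cosh r) sends (v, w) to
  (e, 0) with e = cosh r v + sinh r w; the inverse rotation gives both equations.\<close>

lemma hyperbolic_rotation:
  fixes v w :: "'a::real_vector"
  assumes "cosh r *\<^sub>R w + sinh r *\<^sub>R v = 0"
  shows "v = cosh r *\<^sub>R (cosh r *\<^sub>R v + sinh r *\<^sub>R w)"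
    and "w = - sinh r *\<^sub>R (cosh r *\<^sub>R v + sinh r *\<^sub>R w)"
proof -
  have w: "cosh r *\<^sub>R w = - (sinh r *\<^sub>R v)"
    using assms by (simp add: eq_neg_iff_add_eq_0)
  have 1: "cosh r * cosh r = sinh r * sinh r + 1"
    using cosh_square_eq[of r] by (simp add: power2_eq_square)
  have "cosh r *\<^sub>R (cosh r *\<^sub>R v + sinh r *\<^sub>R w) = (cosh r * cosh r) *\<^sub>R v + sinh r *\<^sub>R cosh r *\<^sub>R w"
    by (simp add: scaleR_right_distrib mult.commute)
  also have "\<dots> = v"
    unfolding w 1 by (simp add: scaleR_left_distrib)
  finally show "v = cosh r *\<^sub>R (cosh r *\<^sub>R v + sinh r *\<^sub>R w)" ..
  have "- sinh r *\<^sub>R (cosh r *\<^sub>R v + sinh r *\<^sub>R w)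
      = cosh r *\<^sub>R (- (sinh r *\<^sub>R v)) - (sinh r * sinh r) *\<^sub>R w"
    by (simp add: scaleR_right_distrib mult.commute)
  also have "\<dots> = (cosh r * cosh r) *\<^sub>R w - (sinh r * sinh r) *\<^sub>R w"
    unfolding w[symmetric] by simp
  also have "\<dots> = w"
    unfolding 1 by (simp add: scaleR_left_distrib)
  finally show "w = - sinh r *\<^sub>R (cosh r *\<^sub>R v + sinh r *\<^sub>R w)" ..
qed

lemma has_derivative_cosh_compose:
  fixes g :: "'a::real_normed_vector \<Rightarrow> real"
  assumes "(g has_derivative g') (at x)"
  shows "((\<lambda>y. cosh (g y)) has_derivative (\<lambda>X. g' X * sinh (g x))) (at x)"
proof -
  have "(cosh has_derivative (*) (sinh (g x))) (at (g x))"
    unfolding has_field_derivative_def[symmetric] by (auto intro!: derivative_eq_intros)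
  from has_derivative_compose[OF assms this] show ?thesis
    by (simp add: mult.commute)
qed

lemma has_derivative_sinh_compose:
  fixes g :: "'a::real_normed_vector \<Rightarrow> real"
  assumes "(g has_derivative g') (at x)"
  shows "((\<lambda>y. sinh (g y)) has_derivative (\<lambda>X. g' X * cosh (g x))) (at x)"
proof -
  have "(sinh has_derivative (*) (cosh (g x))) (at (g x))"
    unfolding has_field_derivative_def[symmetric] by (auto intro!: derivative_eq_intros)
  from has_derivative_compose[OF assms this] show ?thesis
    by (simp add: mult.commute)
qed

section \<open>The frame along the curvature lines and its structure equations\<close>

locale curvature_line_pair = legendre_pair \<pp> \<qq> U \<ff> \<tt>
  for \<pp> \<qq> U \<ff> \<tt> +
  fixes \<phi> :: "real^2 \<Rightarrow> real"
  assumes smooth_phi: "smooth_map U \<phi>"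
    and curv_u: "\<And>x. x \<in> U \<Longrightarrow>
      cosh (\<phi> x) *\<^sub>R pderivative 1 \<tt> x + sinh (\<phi> x) *\<^sub>R pderivative 1 \<ff> x = 0"
    and curv_v: "\<And>x. x \<in> U \<Longrightarrow>
      sinh (\<phi> x) *\<^sub>R pderivative 2 \<tt> x + cosh (\<phi> x) *\<^sub>R pderivative 2 \<ff> x = 0"
    and regular: "\<And>x X. x \<in> U \<Longrightarrow> dirderiv \<ff> x X = 0 \<Longrightarrow> dirderiv \<tt> x X = 0 \<Longrightarrow> X = 0"
begin

text \<open>Modulo the lift, \<open>e1\<close> is the u-derivative of the curvature sphere s_2, and
  \<open>e2\<close> is the v-derivative of s_1. Unlike the partial derivatives of \<ff>, they vanish
  nowhere, even where \<ff> fails to immerse.\<close>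

definition e1 :: "real^2 \<Rightarrow> real^6"
  where "e1 x = cosh (\<phi> x) *\<^sub>R pderivative 1 \<ff> x + sinh (\<phi> x) *\<^sub>R pderivative 1 \<tt> x"

definition e2 :: "real^2 \<Rightarrow> real^6"
  where "e2 x = sinh (\<phi> x) *\<^sub>R pderivative 2 \<ff> x + cosh (\<phi> x) *\<^sub>R pderivative 2 \<tt> x"

definition E :: "real^2 \<Rightarrow> real"
  where "E x = ip (e1 x) (e1 x)"

definition G :: "real^2 \<Rightarrow> real"
  where "G x = ip (e2 x) (e2 x)"

lemma pderivatives:
  assumes "x \<in> U"
  shows "pderivative 1 \<ff> x = cosh (\<phi> x) *\<^sub>R e1 x" "pderivative 1 \<tt> x = - sinh (\<phi> x) *\<^sub>R e1 x"
    "pderivative 2 \<ff> x = - sinh (\<phi> x) *\<^sub>R e2 x" "pderivative 2 \<tt> x = cosh (\<phi> x) *\<^sub>R e2 x"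
  using hyperbolic_rotation[OF curv_u[OF assms]]
    hyperbolic_rotation[of "\<phi> x" "pderivative 2 \<ff> x" "pderivative 2 \<tt> x"]
    hyperbolic_rotation[of "\<phi> x" "pderivative 2 \<tt> x" "pderivative 2 \<ff> x"] curv_v[OF assms]
  by (simp_all add: e1_def e2_def add.commute)

lemma e_nonzero:
  assumes "x \<in> U"
  shows "e1 x \<noteq> 0" "e2 x \<noteq> 0"
  using regular[OF assms, of "axis 1 1"] regular[OF assms, of "axis 2 1"] pderivatives[OF assms]
  by (auto simp: axis_eq_0_iff)

lemma ip_e:
  assumes "x \<in> U"
  shows "ip (e1 x) \<pp> = 0" "ip (e1 x) (\<ff> x) = 0" "ip (e2 x) \<pp> = 0" "ip (e2 x) (\<ff> x) = 0"
  using assms by (simp_all add: e1_def e2_def ips)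

text \<open>Both frame vectors are orthogonal to \<pp> and \<ff> x, two orthonormal timelike vectors
  that exhaust the negative part of signature (4,2).\<close>

lemma E_G_pos:
  assumes "x \<in> U"
  shows "E x > 0" "G x > 0"
proof -
  have "ip \<pp> (\<ff> x) = 0" using assms by (simp add: ips)
  note * = orthogonal_to_timelike_plane[OF pq(1) normalized(1)[OF assms] this]
  show "E x > 0" "G x > 0"
    unfolding E_def G_def using *[OF ip_e(1,2)[OF assms] e_nonzero(1)[OF assms]]
      *[OF ip_e(3,4)[OF assms] e_nonzero(2)[OF assms]] by auto
qed

lemma dirderiv_hyperbolic_rotation:
  assumes "smooth_map U g" "smooth_map U h" "x \<in> U"
  shows "((\<lambda>y. cosh (\<phi> y) *\<^sub>R g y + sinh (\<phi> y) *\<^sub>R h y) has_derivative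
    (\<lambda>X. dirderiv \<phi> x X *\<^sub>R (sinh (\<phi> x) *\<^sub>R g x + cosh (\<phi> x) *\<^sub>R h x)
      + (cosh (\<phi> x) *\<^sub>R dirderiv g x X + sinh (\<phi> x) *\<^sub>R dirderiv h x X))) (at x)"
proof -
  note d = smooth_map_has_derivative[OF smooth_phi assms(3)]
  note c = has_derivative_cosh_compose[OF d] and s = has_derivative_sinh_compose[OF d]
  show ?thesis
    by (rule derivative_eq_intros c s smooth_map_has_derivative[OF assms(1,3)]
        smooth_map_has_derivative[OF assms(2,3)] refl)+
      (simp add: algebra_simps fun_eq_iff)
qed

lemma smooth_pderivatives: "smooth_map U (pderivative i \<ff>)" "smooth_map U (pderivative i \<tt>)"
  using smooth by (simp_all add: smooth_map_dirderiv)

lemma e1_has_derivative: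
  assumes "x \<in> U"
  shows "(e1 has_derivative
    (\<lambda>X. dirderiv \<phi> x X *\<^sub>R (sinh (\<phi> x) *\<^sub>R pderivative 1 \<ff> x + cosh (\<phi> x) *\<^sub>R pderivative 1 \<tt> x)
      + (cosh (\<phi> x) *\<^sub>R dirderiv (pderivative 1 \<ff>) x X + sinh (\<phi> x) *\<^sub>R dirderiv (pderivative 1 \<tt>) x X)))
    (at x)"
  unfolding e1_def[abs_def] by (intro dirderiv_hyperbolic_rotation smooth_pderivatives assms)

lemma e2_has_derivative:
  assumes "x \<in> U"
  shows "(e2 has_derivative
    (\<lambda>X. dirderiv \<phi> x X *\<^sub>R (sinh (\<phi> x) *\<^sub>R pderivative 2 \<tt> x + cosh (\<phi> x) *\<^sub>R pderivative 2 \<ff> x)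
      + (cosh (\<phi> x) *\<^sub>R dirderiv (pderivative 2 \<tt>) x X + sinh (\<phi> x) *\<^sub>R dirderiv (pderivative 2 \<ff>) x X)))
    (at x)"
  unfolding e2_def[abs_def] add.commute[of "sinh _ *\<^sub>R _"]
  by (rule dirderiv_hyperbolic_rotation[OF smooth_pderivatives(2,1) assms,
        unfolded add.commute[of "sinh _ *\<^sub>R _"]])

text \<open>A Codazzi-type equation: \<open>curv_v\<close> is differentiated along u, the mixed
  derivatives are interchanged, and \<open>curv_u\<close> removes the term with the v-derivative of
  \<phi>.\<close>

lemma e1_pderivative_2:
  assumes "x \<in> U"
  shows "pderivative 2 e1 x = - pderivative 1 \<phi> x *\<^sub>R e2 x"
proof -
  have "pderivative 1 (\<lambda>y. cosh (\<phi> y) *\<^sub>R pderivative 2 \<ff> y + sinh (\<phi> y) *\<^sub>R pderivative 2 \<tt> y) x = 0"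
    using curv_v by (intro dirderiv_const_on[OF open_U assms]) (simp add: add.commute)
  then have "pderivative 1 \<phi> x *\<^sub>R e2 x + (cosh (\<phi> x) *\<^sub>R pderivative 1 (pderivative 2 \<ff>) x
      + sinh (\<phi> x) *\<^sub>R pderivative 1 (pderivative 2 \<tt>) x) = 0"
    unfolding dirderiv_eqI[OF dirderiv_hyperbolic_rotation[OF smooth_pderivatives assms]] e2_def .
  moreover have "sinh (\<phi> x) *\<^sub>R pderivative 1 \<ff> x + cosh (\<phi> x) *\<^sub>R pderivative 1 \<tt> x = 0"
    using curv_u[OF assms] by (simp add: add.commute)
  ultimately show ?thesis
    unfolding dirderiv_eqI[OF e1_has_derivative[OF assms]]
      symmetric_second_dirderiv[OF open_U smooth(1) assms, of "axis 1 1" "axis 2 1"]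
      symmetric_second_dirderiv[OF open_U smooth(2) assms, of "axis 1 1" "axis 2 1"]
    by (simp add: eq_neg_iff_add_eq_0 add.commute)
qed

lemma e2_pderivative_1:
  assumes "x \<in> U"
  shows "pderivative 1 e2 x = - pderivative 2 \<phi> x *\<^sub>R e1 x"
proof -
  have "pderivative 2 (\<lambda>y. cosh (\<phi> y) *\<^sub>R pderivative 1 \<tt> y + sinh (\<phi> y) *\<^sub>R pderivative 1 \<ff> y) x = 0"
    using curv_u by (intro dirderiv_const_on[OF open_U assms]) simp
  then have "pderivative 2 \<phi> x *\<^sub>R e1 x + (cosh (\<phi> x) *\<^sub>R pderivative 2 (pderivative 1 \<tt>) x
      + sinh (\<phi> x) *\<^sub>R pderivative 2 (pderivative 1 \<ff>) x) = 0"
    unfolding dirderiv_eqI[OF dirderiv_hyperbolic_rotation[OF smooth_pderivatives(2,1) assms]] e1_def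
    by (simp add: add.commute)
  then show ?thesis
    unfolding dirderiv_eqI[OF e2_has_derivative[OF assms]] curv_v[OF assms]
      symmetric_second_dirderiv[OF open_U smooth(1) assms, of "axis 2 1" "axis 1 1"]
      symmetric_second_dirderiv[OF open_U smooth(2) assms, of "axis 2 1" "axis 1 1"]
    by (simp add: eq_neg_iff_add_eq_0 add.commute)
qed

text \<open>Symmetry of the second fundamental form gives $\cosh^2\varphi\,(e_1,e_2) = \sinh^2\varphi\,(e_1,e_2)$.\<close>

lemma e1_e2_orthogonal:
  assumes "x \<in> U"
  shows "ip (e1 x) (e2 x) = 0" "ip (e2 x) (e1 x) = 0"
proof -
  have "ip (pderivative 2 \<tt> x) (pderivative 1 \<ff> x) + ip (\<tt> x) (pderivative 2 (pderivative 1 \<ff>) x) = 0"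
    "ip (pderivative 1 \<tt> x) (pderivative 2 \<ff> x) + ip (\<tt> x) (pderivative 1 (pderivative 2 \<ff>) x) = 0"
    by (rule ip_const_dirderiv[OF open_U smooth(2) smooth_pderivatives(1) assms normal]; assumption)+
  then have "ip (pderivative 2 \<tt> x) (pderivative 1 \<ff> x) = ip (pderivative 1 \<tt> x) (pderivative 2 \<ff> x)"
    using symmetric_second_dirderiv[OF open_U smooth(1) assms, of "axis 1 1" "axis 2 1"] by simp
  then have "(cosh (\<phi> x))\<^sup>2 * ip (e1 x) (e2 x) = (sinh (\<phi> x))\<^sup>2 * ip (e1 x) (e2 x)"
    unfolding pderivatives[OF assms] using ip_commute[of "e2 x" "e1 x"]
    by (simp add: ip_simps power2_eq_square)
  then show "ip (e1 x) (e2 x) = 0" "ip (e2 x) (e1 x) = 0"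
    using ip_commute[of "e2 x" "e1 x"] by (simp_all add: cosh_square_eq algebra_simps)
qed

text \<open>The v-derivative of \<open>E\<close> is 2 (e1, e1_v), and e1_v is a multiple of
  \<open>e2\<close>, which is orthogonal to \<open>e1\<close>; likewise for
  \<open>G\<close>.\<close>

lemma E_G_differentiable:
  assumes "x \<in> U"
  shows "E differentiable (at x)" "G differentiable (at x)"
    and "pderivative 2 E x = 0" "pderivative 1 G x = 0"
proof -
  have e: "(e1 has_derivative dirderiv e1 x) (at x)" "(e2 has_derivative dirderiv e2 x) (at x)"
    using e1_has_derivative[OF assms] e2_has_derivative[OF assms]
    by (auto intro!: dirderiv_has_derivative differentiableI)
  have "(E has_derivative (\<lambda>X. ip (e1 x) (dirderiv e1 x X) + ip (dirderiv e1 x X) (e1 x))) (at x)"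
    unfolding E_def[abs_def] by (intro ip.FDERIV e)
  moreover have "(G has_derivative (\<lambda>X. ip (e2 x) (dirderiv e2 x X) + ip (dirderiv e2 x X) (e2 x))) (at x)"
    unfolding G_def[abs_def] by (intro ip.FDERIV e)
  ultimately show "E differentiable (at x)" "G differentiable (at x)"
    "pderivative 2 E x = 0" "pderivative 1 G x = 0"
    using assms
    by (auto simp: differentiable_def dirderiv_eqI e1_pderivative_2 e2_pderivative_1 ip_simps
        e1_e2_orthogonal)
qed

lemma hyperbolic_has_derivative:
  assumes "x \<in> U"
  shows "((\<lambda>y. cosh (\<phi> y - r)) has_derivative (\<lambda>X. dirderiv \<phi> x X * sinh (\<phi> x - r))) (at x)"
    and "((\<lambda>y. sinh (\<phi> y - r)) has_derivative (\<lambda>X. dirderiv \<phi> x X * cosh (\<phi> x - r))) (at x)"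
proof -
  have d: "((\<lambda>y. \<phi> y - r) has_derivative dirderiv \<phi> x) (at x)"
    by (auto intro!: derivative_eq_intros smooth_map_has_derivative[OF smooth_phi assms])
  show "((\<lambda>y. cosh (\<phi> y - r)) has_derivative (\<lambda>X. dirderiv \<phi> x X * sinh (\<phi> x - r))) (at x)"
    "((\<lambda>y. sinh (\<phi> y - r)) has_derivative (\<lambda>X. dirderiv \<phi> x X * cosh (\<phi> x - r))) (at x)"
    by (rule has_derivative_cosh_compose[OF d] has_derivative_sinh_compose[OF d])+
qed

section \<open>Derivatives and metrics of the parallel fronts\<close>

lemma parallel_front_dirderiv:
  assumes "f differentiable (at x)" "t differentiable (at x)"
  shows "parallel_front r f t differentiable (at x)"
    and "dirderiv (parallel_front r f t) x X = cosh r *\<^sub>R dirderiv f x X + sinh r *\<^sub>R dirderiv t x X"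
proof -
  have "(parallel_front r f t has_derivative
      (\<lambda>X. cosh r *\<^sub>R dirderiv f x X + sinh r *\<^sub>R dirderiv t x X)) (at x)"
    unfolding parallel_front_def[abs_def]
    by (auto intro!: derivative_eq_intros dirderiv_has_derivative assms)
  then show "parallel_front r f t differentiable (at x)"
    and "dirderiv (parallel_front r f t) x X = cosh r *\<^sub>R dirderiv f x X + sinh r *\<^sub>R dirderiv t x X"
    by (rule differentiableI, rule dirderiv_eqI)
qed

text \<open>By the addition theorems, passing to the parallel front replaces \<phi> by \<phi> - r
  and keeps the frame. The last two equations serve the case where \<ff> and \<tt> are
  exchanged.\<close>

lemma parallel_pderivatives:
  assumes "x \<in> U"
  shows "cosh r *\<^sub>R pderivative 1 \<ff> x + sinh r *\<^sub>R pderivative 1 \<tt> x = cosh (\<phi> x - r) *\<^sub>R e1 x"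
    "cosh r *\<^sub>R pderivative 2 \<ff> x + sinh r *\<^sub>R pderivative 2 \<tt> x = - sinh (\<phi> x - r) *\<^sub>R e2 x"
    "cosh r *\<^sub>R pderivative 1 \<tt> x + sinh r *\<^sub>R pderivative 1 \<ff> x = - sinh (\<phi> x - r) *\<^sub>R e1 x"
    "cosh r *\<^sub>R pderivative 2 \<tt> x + sinh r *\<^sub>R pderivative 2 \<ff> x = cosh (\<phi> x - r) *\<^sub>R e2 x"
  unfolding pderivatives[OF assms] cosh_diff sinh_diff
  by (simp_all add: algebra_simps)

text \<open>The derivatives of the deformed fronts are those of \<open>\<ff>\<close> and \<open>\<tt>\<close>, possibly exchanged, up to a
  constant factor and a pointwise orthogonal transformation.\<close>

lemma gauss_curvature_parallel_front:
  assumes g: "g1 = \<ff> \<and> g2 = \<tt> \<or> g1 = \<tt> \<and> g2 = \<ff>"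
    and d: "\<And>y. y \<in> U \<Longrightarrow> f differentiable (at y)" "\<And>y. y \<in> U \<Longrightarrow> t differentiable (at y)"
    and f: "\<And>y X. y \<in> U \<Longrightarrow> dirderiv f y X = c *\<^sub>R (M y *v dirderiv g1 y X)"
    and t: "\<And>y X. y \<in> U \<Longrightarrow> dirderiv t y X = c *\<^sub>R (M y *v dirderiv g2 y X)"
    and M: "\<And>y. y \<in> U \<Longrightarrow> M y \<in> O42" and c: "c \<noteq> 0"
    and x: "x \<in> U"
  shows "immersed_at (parallel_front r f t) x \<longleftrightarrow> sinh (\<phi> x - r) \<noteq> 0"
    and "sinh (\<phi> x - r) \<noteq> 0 \<Longrightarrow>
      gauss_curvature (induced_metric (parallel_front r f t)) x = 0 \<longleftrightarrow> flatness_defect E G \<phi> x = 0"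
proof -
  \<comment> \<open>Both assignments of \<ff> and \<tt> are brought to one shape; the signs
    \<open>sa\<close> and \<open>sb\<close> disappear in the metric.\<close>
  obtain a b :: "real^2 \<Rightarrow> real" and sa sb :: real where
    ab: "a = (\<lambda>y. cosh (\<phi> y - r)) \<and> b = (\<lambda>y. sinh (\<phi> y - r)) \<or>
         a = (\<lambda>y. sinh (\<phi> y - r)) \<and> b = (\<lambda>y. cosh (\<phi> y - r))"
    and s: "sa\<^sup>2 = 1" "sb\<^sup>2 = 1"
    and dg: "\<And>y. y \<in> U \<Longrightarrow> cosh r *\<^sub>R pderivative 1 g1 y + sinh r *\<^sub>R pderivative 1 g2 y = (sa * a y) *\<^sub>R e1 y"
      "\<And>y. y \<in> U \<Longrightarrow> cosh r *\<^sub>R pderivative 2 g1 y + sinh r *\<^sub>R pderivative 2 g2 y = (sb * b y) *\<^sub>R e2 y"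
  proof (cases "g1 = \<ff> \<and> g2 = \<tt>")
    case True
    then show ?thesis
      using that[of "\<lambda>y. cosh (\<phi> y - r)" "\<lambda>y. sinh (\<phi> y - r)" 1 "-1"] parallel_pderivatives by simp
  next
    case False
    with g have "g1 = \<tt>" "g2 = \<ff>" by auto
    then show ?thesis
      using that[of "\<lambda>y. sinh (\<phi> y - r)" "\<lambda>y. cosh (\<phi> y - r)" "-1" 1] parallel_pderivatives by simp
  qed
  have pd: "pderivative 1 (parallel_front r f t) y = (c * sa * a y) *\<^sub>R (M y *v e1 y)"
    "pderivative 2 (parallel_front r f t) y = (c * sb * b y) *\<^sub>R (M y *v e2 y)" if y: "y \<in> U" for y
  proof -
    have D: "dirderiv (parallel_front r f t) y X
        = c *\<^sub>R (M y *v (cosh r *\<^sub>R dirderiv g1 y X + sinh r *\<^sub>R dirderiv g2 y X))" for X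
      by (simp add: parallel_front_dirderiv[OF d[OF y]] f t y algebra_simps)
    show "pderivative 1 (parallel_front r f t) y = (c * sa * a y) *\<^sub>R (M y *v e1 y)"
      "pderivative 2 (parallel_front r f t) y = (c * sb * b y) *\<^sub>R (M y *v e2 y)"
      unfolding D dg[OF y] by (simp_all add: matrix_vector_mult_scaleR mult.assoc)
  qed
  \<comment> \<open>One of \<open>a\<close>, \<open>b\<close> is a cosh and never zero, so the other
    alone decides, for either assignment.\<close>
  have nz: "a y \<noteq> 0 \<and> b y \<noteq> 0 \<longleftrightarrow> sinh (\<phi> y - r) \<noteq> 0" for y
    using ab by (elim disjE conjE) simp_all
  have s0: "sa \<noteq> 0" "sb \<noteq> 0" using s by auto
  have diff: "parallel_front r f t differentiable (at x)"
    by (rule parallel_front_dirderiv[OF d[OF x]])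
  have lin: "linear (dirderiv (parallel_front r f t) x)"
    by (rule linear_frechet_derivative[OF diff])
  have ax: "M x *v e1 x \<noteq> 0" "M x *v e2 x \<noteq> 0"
    using e_nonzero[OF x] O42_mult_eq_0_iff[OF M[OF x]] by auto
  have orthM: "ip (M y *v e1 y) (M y *v e2 y) = 0" "ip (M y *v e2 y) (M y *v e1 y) = 0"
    "ip (M y *v e1 y) (M y *v e1 y) = E y" "ip (M y *v e2 y) (M y *v e2 y) = G y" if "y \<in> U" for y
    using that by (simp_all add: O42_ip M e1_e2_orthogonal E_def G_def)
  show "immersed_at (parallel_front r f t) x \<longleftrightarrow> sinh (\<phi> x - r) \<noteq> 0"
  proof
    assume "immersed_at (parallel_front r f t) x"
    then have inj: "\<forall>X. dirderiv (parallel_front r f t) x X = 0 \<longrightarrow> X = 0"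
      unfolding immersed_at_def linear_injective_0[OF lin] by blast
    have "axis i 1 \<noteq> (0 :: real^2)" for i
      by simp
    then have "pderivative 1 (parallel_front r f t) x \<noteq> 0" "pderivative 2 (parallel_front r f t) x \<noteq> 0"
      using inj by blast+
    then have "a x \<noteq> 0" "b x \<noteq> 0"
      unfolding pd[OF x] by auto
    then show "sinh (\<phi> x - r) \<noteq> 0"
      using nz[of x] by blast
  next
    assume nz0: "sinh (\<phi> x - r) \<noteq> 0"
    have "X = 0" if X: "dirderiv (parallel_front r f t) x X = 0" for X
    proof -
      define \<alpha> \<beta> where "\<alpha> = X $ 1 * (c * sa * a x)" and "\<beta> = X $ 2 * (c * sb * b x)"
      have z: "\<alpha> *\<^sub>R (M x *v e1 x) + \<beta> *\<^sub>R (M x *v e2 x) = 0"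
        using X unfolding dirderiv_linear_combination[OF diff, of X] pd[OF x] by (simp add: \<alpha>_def \<beta>_def)
      have "ip (\<alpha> *\<^sub>R (M x *v e1 x) + \<beta> *\<^sub>R (M x *v e2 x)) (M x *v e1 x) = \<alpha> * E x"
        "ip (\<alpha> *\<^sub>R (M x *v e1 x) + \<beta> *\<^sub>R (M x *v e2 x)) (M x *v e2 x) = \<beta> * G x"
        by (simp_all add: ip_simps orthM x)
      then have "\<alpha> = 0" "\<beta> = 0"
        unfolding z using E_G_pos[OF x] by (simp_all add: ip_simps)
      then show ?thesis
        using nz[of x] nz0 c s0 by (simp add: \<alpha>_def \<beta>_def vec_eq_iff forall_2)
    qed
    then show "immersed_at (parallel_front r f t) x"
      unfolding immersed_at_def linear_injective_0[OF lin] using diff by blast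
  qed
  assume nz0: "sinh (\<phi> x - r) \<noteq> 0"
  define V where "V = {y \<in> U. sinh (\<phi> y - r) \<noteq> 0}"
  have "open V"
    unfolding V_def
    by (intro open_nonzero_set[OF open_U] continuous_intros smooth_map_continuous_on smooth_phi)
  then have V: "open V" "x \<in> V" and VU: "\<And>y. y \<in> V \<Longrightarrow> y \<in> U" and Vnz: "\<And>y. y \<in> V \<Longrightarrow> a y \<noteq> 0 \<and> b y \<noteq> 0"
    using x nz0 nz by (auto simp: V_def)
  have der: "(a has_derivative (\<lambda>X. dirderiv \<phi> y X * b y)) (at y)"
    "(b has_derivative (\<lambda>X. dirderiv \<phi> y X * a y)) (at y)" if "y \<in> V" for y
    using ab hyperbolic_has_derivative[OF VU[OF that], of r] by auto
  have kE: "(\<lambda>z. c\<^sup>2 * E z) differentiable (at y)" "pderivative 2 (\<lambda>z. c\<^sup>2 * E z) y = 0"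
    "(\<lambda>z. c\<^sup>2 * G z) differentiable (at y)" "pderivative 1 (\<lambda>z. c\<^sup>2 * G z) y = 0" if "y \<in> U" for y
    using E_G_differentiable[OF that] by (simp_all add: dirderiv_mult)
  have "gauss_curvature (induced_metric (parallel_front r f t)) x
      = - flatness_defect (\<lambda>y. c\<^sup>2 * E y) (\<lambda>y. c\<^sup>2 * G y) \<phi> x / (c\<^sup>2 * G x * a x * b x)"
  proof (rule gauss_curvature_eq_flatness_defect[OF V])
    fix y assume y: "y \<in> V"
    define ka kb where "ka = c * sa * a y" and "kb = c * sb * b y"
    have sq: "ka * ka = c\<^sup>2 * (a y)\<^sup>2" "kb * kb = c\<^sup>2 * (b y)\<^sup>2"
      using s by (simp_all add: ka_def kb_def power2_eq_square algebra_simps)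
    have k: "ka * (ka * E y) = c\<^sup>2 * E y * (a y)\<^sup>2" "kb * (kb * G y) = c\<^sup>2 * G y * (b y)\<^sup>2"
      unfolding mult.assoc[symmetric] sq by simp_all
    show "induced_metric (parallel_front r f t) y $ 1 $ 1 = c\<^sup>2 * E y * (a y)\<^sup>2"
      "induced_metric (parallel_front r f t) y $ 2 $ 2 = c\<^sup>2 * G y * (b y)\<^sup>2"
      "induced_metric (parallel_front r f t) y $ 1 $ 2 = 0"
      "induced_metric (parallel_front r f t) y $ 2 $ 1 = 0"
      unfolding induced_metric_def pd[OF VU[OF y], folded ka_def kb_def]
      by (simp_all add: pd[OF VU[OF y], folded ka_def kb_def] orthM VU y ip.scaleR_left ip.scaleR_right k)
    show "c\<^sup>2 * E y \<noteq> 0" "c\<^sup>2 * G y \<noteq> 0" "a y \<noteq> 0" "b y \<noteq> 0"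
      using c E_G_pos[OF VU[OF y]] Vnz[OF y] by auto
    show "(\<lambda>z. c\<^sup>2 * E z) differentiable (at y)" "pderivative 2 (\<lambda>z. c\<^sup>2 * E z) y = 0"
      "(\<lambda>z. c\<^sup>2 * G z) differentiable (at y)" "pderivative 1 (\<lambda>z. c\<^sup>2 * G z) y = 0"
      by (rule kE[OF VU[OF y]])+
    show "(a has_derivative (\<lambda>X. dirderiv \<phi> y X * b y)) (at y)"
      "(b has_derivative (\<lambda>X. dirderiv \<phi> y X * a y)) (at y)"
      by (rule der[OF y])+
  next
    show "pderivative i \<phi> differentiable (at x)" for i
      by (rule smooth_map_differentiable[OF smooth_map_dirderiv[OF smooth_phi] x])
  qed
  also have "flatness_defect (\<lambda>y. c\<^sup>2 * E y) (\<lambda>y. c\<^sup>2 * G y) \<phi> x = flatness_defect E G \<phi> x"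
    using c E_G_differentiable[OF x] by (intro flatness_defect_scale) auto
  finally show "gauss_curvature (induced_metric (parallel_front r f t)) x = 0 \<longleftrightarrow>
      flatness_defect E G \<phi> x = 0"
    using c E_G_pos[OF x] Vnz[OF V(2)] by simp
qed

end

section \<open>Lie geometric deformation\<close>

lemma wedge_self: "wedge a a = 0"
  by (simp add: matrix_eq wedge_mult_vec)

lemma wedge_commute: "wedge a b = - wedge b a"
proof -
  have "wedge a b + wedge b a = wedge (a + b) (a + b)"
    by (simp only: wedge.add_left wedge.add_right wedge_self[of a] wedge_self[of b]
        add_0_left add_0_right add.commute)
  then show ?thesis
    by (simp add: wedge_self eq_neg_iff_add_eq_0)
qed

context curvature_line_pair
begin

text \<open>In the frame, d(\<tt> + \<ff>) = exp(-\<phi>) (e1 du + e2 dv) and d(\<ff> - \<tt>) =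
  exp(\<phi>) (e1 du - e2 dv); reversing the sign of dv turns one into the other up to
  exp(2\<phi>).\<close>

lemma star_relation:
  assumes "x \<in> U"
  shows "(exp (\<phi> x) * exp (\<phi> x)) *\<^sub>R (dirderiv \<tt> x (star_vec X) + dirderiv \<ff> x (star_vec X))
    = dirderiv \<ff> x X - dirderiv \<tt> x X"
proof -
  have 1: "exp (\<phi> x) * exp (\<phi> x) * (cosh (\<phi> x) - sinh (\<phi> x)) = cosh (\<phi> x) + sinh (\<phi> x)"
    by (simp add: cosh_minus_sinh cosh_plus_sinh exp_minus)
  have "dirderiv \<tt> x (star_vec X) + dirderiv \<ff> x (star_vec X)
      = (cosh (\<phi> x) - sinh (\<phi> x)) *\<^sub>R (X $ 1 *\<^sub>R e1 x - X $ 2 *\<^sub>R e2 x)"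
    unfolding deriv[OF assms, THEN differentiableI, THEN dirderiv_linear_combination, of "star_vec X"]
      pderivatives[OF assms] by (simp add: star_vec_def algebra_simps)
  then have "(exp (\<phi> x) * exp (\<phi> x)) *\<^sub>R (dirderiv \<tt> x (star_vec X) + dirderiv \<ff> x (star_vec X))
      = (cosh (\<phi> x) + sinh (\<phi> x)) *\<^sub>R (X $ 1 *\<^sub>R e1 x - X $ 2 *\<^sub>R e2 x)"
    by (simp only: scaleR_scaleR 1)
  also have "\<dots> = dirderiv \<ff> x X - dirderiv \<tt> x X"
    unfolding deriv[OF assms, THEN differentiableI, THEN dirderiv_linear_combination, of X]
      pderivatives[OF assms] by (simp add: algebra_simps)
  finally show ?thesis .
qed

text \<open>All traces of \<phi> cancel: the two exponential factors in the first term make up the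
  factor of \<open>star_relation\<close>, d\<phi> is paired with s^+ itself, and the factors of s^+
  and s^- are inverse to each other.\<close>

lemma tau_eq:
  assumes "x \<in> U"
  shows "tau \<pp> \<qq> \<ff> \<tt> \<phi> x X
    = wedge (\<qq> + \<ff> x) (dirderiv \<ff> x X) - wedge (\<pp> + \<tt> x) (dirderiv \<tt> x X)"
proof -
  define a b where "a = \<qq> + \<ff> x" and "b = \<pp> + \<tt> x"
  define df dt where "df = dirderiv \<ff> x X" and "dt = dirderiv \<tt> x X"
  note d = deriv[OF assms] smooth_map_has_derivative[OF smooth_phi assms]
  have sp: "dirderiv (s_plus \<pp> \<qq> \<ff> \<tt> \<phi>) x Z = exp (\<phi> x) *\<^sub>R
      (dirderiv \<phi> x Z *\<^sub>R (a + b) + (dirderiv \<tt> x Z + dirderiv \<ff> x Z))" for Z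
    unfolding s_plus_def[abs_def] a_def b_def
    by (rule dirderiv_eqI) (auto intro!: derivative_eq_intros d simp: algebra_simps)
  have "wedge (s_plus \<pp> \<qq> \<ff> \<tt> \<phi> x) (dirderiv (s_plus \<pp> \<qq> \<ff> \<tt> \<phi>) x (star_vec X))
      = wedge (exp (\<phi> x) *\<^sub>R (a + b)) (exp (\<phi> x) *\<^sub>R (dirderiv \<phi> x (star_vec X) *\<^sub>R (a + b)
        + (dirderiv \<tt> x (star_vec X) + dirderiv \<ff> x (star_vec X))))"
    unfolding sp by (simp add: s_plus_def a_def b_def add_ac)
  also have "\<dots> = wedge (a + b)
      ((exp (\<phi> x) * exp (\<phi> x)) *\<^sub>R (dirderiv \<tt> x (star_vec X) + dirderiv \<ff> x (star_vec X)))"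
    by (simp only: wedge.scaleR_left wedge.scaleR_right wedge.add_right[of "a + b" "_ *\<^sub>R (a + b)"]
        wedge_self[of "a + b"] scaleR_zero_right add_0_left scaleR_scaleR)
  also have "\<dots> = wedge (a + b) (df - dt)"
    unfolding star_relation[OF assms] df_def dt_def ..
  finally have first: "wedge (s_plus \<pp> \<qq> \<ff> \<tt> \<phi> x) (dirderiv (s_plus \<pp> \<qq> \<ff> \<tt> \<phi>) x (star_vec X))
      = wedge (a + b) (df - dt)" .
  have "wedge (s_plus \<pp> \<qq> \<ff> \<tt> \<phi> y) (s_minus \<pp> \<qq> \<ff> \<tt> \<phi> y)
      = wedge (\<pp> + \<qq> + \<tt> y + \<ff> y) (\<pp> - \<qq> + \<tt> y - \<ff> y)" for y
    by (simp add: s_plus_def s_minus_def wedge.scaleR_left wedge.scaleR_right exp_minus)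
  moreover have "dirderiv (\<lambda>y. wedge (\<pp> + \<qq> + \<tt> y + \<ff> y) (\<pp> - \<qq> + \<tt> y - \<ff> y)) x X
      = wedge (a + b) (dt - df) + wedge (dt + df) (b - a)"
  proof -
    have "((\<lambda>y. \<pp> + \<qq> + \<tt> y + \<ff> y) has_derivative (\<lambda>X. dirderiv \<tt> x X + dirderiv \<ff> x X)) (at x)"
      "((\<lambda>y. \<pp> - \<qq> + \<tt> y - \<ff> y) has_derivative (\<lambda>X. dirderiv \<tt> x X - dirderiv \<ff> x X)) (at x)"
      by (auto intro!: derivative_eq_intros d)
    from dirderiv_eqI[OF wedge.FDERIV[OF this]] show ?thesis
      by (simp add: a_def b_def df_def dt_def algebra_simps)
  qed
  ultimately have "tau \<pp> \<qq> \<ff> \<tt> \<phi> x X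
      = wedge (a + b) (df - dt) + (1/2) *\<^sub>R (wedge (a + b) (dt - df) + wedge (dt + df) (b - a))"
    by (simp add: tau_def Let_def first)
  also have "wedge (a + b) (dt - df) + wedge (dt + df) (b - a) = 2 *\<^sub>R (wedge a dt - wedge b df)"
    by (simp add: wedge.add_left wedge.add_right wedge.diff_left wedge.diff_right
        wedge_commute[of dt] wedge_commute[of df] scaleR_2)
  also have "wedge (a + b) (df - dt) + (1/2) *\<^sub>R 2 *\<^sub>R (wedge a dt - wedge b df) = wedge a df - wedge b dt"
    by (simp add: wedge.add_left wedge.diff_right)
  finally show ?thesis
    unfolding a_def b_def df_def dt_def .
qed

lemma tau_mult_vec:
  assumes "x \<in> U"
  shows "tau \<pp> \<qq> \<ff> \<tt> \<phi> x X *v w =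
    ip (\<qq> + \<ff> x) w *\<^sub>R dirderiv \<ff> x X - ip (dirderiv \<ff> x X) w *\<^sub>R (\<qq> + \<ff> x)
    - (ip (\<pp> + \<tt> x) w *\<^sub>R dirderiv \<tt> x X - ip (dirderiv \<tt> x X) w *\<^sub>R (\<pp> + \<tt> x))"
  by (simp add: tau_eq[OF assms] matrix_vector_mult_diff_rdistrib wedge_mult_vec)

lemma tau_smooth: "smooth_map U (\<lambda>x. tau \<pp> \<qq> \<ff> \<tt> \<phi> x X)"
proof -
  have "smooth_map U (\<lambda>x. wedge (\<qq> + \<ff> x) (dirderiv \<ff> x X) - wedge (\<pp> + \<tt> x) (dirderiv \<tt> x X))"
    by (intro smooth_map_diff[OF open_U] bounded_bilinear_smooth_map[OF bounded_bilinear_wedge open_U]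
        smooth_lift smooth_map_dirderiv smooth)
  then show ?thesis
    unfolding smooth_map_def
    using cont_diff_cong[OF open_U, of _ "\<lambda>x. tau \<pp> \<qq> \<ff> \<tt> \<phi> x X"] tau_eq by simp
qed

end

section \<open>The gauge transformation \<open>T\<close> and its conserved vectors\<close>

locale gauge = curvature_line_pair \<pp> \<qq> U \<ff> \<tt> \<phi>
  for \<pp> \<qq> U \<ff> \<tt> \<phi> +
  fixes lam :: real and T :: "real^2 \<Rightarrow> real^6^6"
  assumes gauge_solution: "gauge_solution \<pp> \<qq> U \<ff> \<tt> \<phi> lam T"
begin

lemma T_in_O42: "x \<in> U \<Longrightarrow> T x \<in> O42"
  and T_deriv: "x \<in> U \<Longrightarrow>
    (T has_derivative (\<lambda>X. T x ** (lam *\<^sub>R tau \<pp> \<qq> \<ff> \<tt> \<phi> x X))) (at x)"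
  using gauge_solution by (auto simp: gauge_solution_def)

text \<open>The differential equation expresses dT through \<open>T\<close> and the smooth form
  \<tau>, so each order of differentiability yields the next.\<close>

lemma T_smooth: "smooth_map U T"
  unfolding smooth_map_def
proof
  fix k show "cont_diff k U T"
  proof (induction k)
    case 0
    then show ?case
      using T_deriv by (auto intro!: continuous_at_imp_continuous_on has_derivative_continuous)
  next
    case (Suc k)
    have "cont_diff k U (\<lambda>x. dirderiv T x X)" for X
    proof (rule cont_diff_cong[OF open_U])
      show "cont_diff k U (\<lambda>x. T x ** (lam *\<^sub>R tau \<pp> \<qq> \<ff> \<tt> \<phi> x X))"
        using smooth_map_scaleR[OF open_U tau_smooth] unfolding smooth_map_def
        by (intro bounded_bilinear_cont_diff[OF bounded_bilinear_matrix_mult open_U] Suc) simp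
    qed (simp add: dirderiv_eqI[OF T_deriv])
    moreover have "T differentiable (at x)" if "x \<in> U" for x
      using T_deriv[OF that] by (rule differentiableI)
    ultimately show ?case
      unfolding cont_diff.simps by blast
  qed
qed

text \<open>\<open>T\<close> carries the connection d + \<open>lam\<close> \<tau> to d, so sections
  parallel for the former become constant vectors.\<close>

lemma T_mult_has_derivative:
  assumes "x \<in> U" "(w has_derivative w') (at x)"
  shows "((\<lambda>y. T y *v w y) has_derivative
    (\<lambda>X. T x *v (w' X + lam *\<^sub>R (tau \<pp> \<qq> \<ff> \<tt> \<phi> x X *v w x)))) (at x)"
proof -
  have "((\<lambda>y. T y *v w y) has_derivative
      (\<lambda>X. T x *v w' X + (T x ** (lam *\<^sub>R tau \<pp> \<qq> \<ff> \<tt> \<phi> x X)) *v w x)) (at x)"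
    by (rule bounded_bilinear.FDERIV[OF bounded_bilinear_matrix_vector_mult T_deriv[OF assms(1)] assms(2)])
  then show ?thesis
    by (simp add: matrix_vector_mul_assoc[symmetric] scaleR_matrix_vector_assoc[symmetric]
        matrix_vector_right_distrib)
qed

text \<open>\<open>\<tau>\<close> annihilates the lift, so that \<open>T\<close> carries derivatives of lift sections to derivatives.\<close>

lemma T_lift_has_derivative:
  assumes "x \<in> U"
  shows "((\<lambda>y. T y *v (\<qq> + \<ff> y)) has_derivative (\<lambda>X. T x *v dirderiv \<ff> x X)) (at x)"
    and "((\<lambda>y. T y *v (\<pp> + \<tt> y)) has_derivative (\<lambda>X. T x *v dirderiv \<tt> x X)) (at x)"
proof -
  have "tau \<pp> \<qq> \<ff> \<tt> \<phi> x X *v (\<qq> + \<ff> x) = 0" "tau \<pp> \<qq> \<ff> \<tt> \<phi> x X *v (\<pp> + \<tt> x) = 0" for X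
    unfolding tau_mult_vec[OF assms] lift_isotropic[OF assms] using assms by (simp_all add: ips)
  note tau_0 = this
  have "((\<lambda>y. \<qq> + \<ff> y) has_derivative dirderiv \<ff> x) (at x)"
    "((\<lambda>y. \<pp> + \<tt> y) has_derivative dirderiv \<tt> x) (at x)"
    using deriv[OF assms] by (auto intro!: derivative_eq_intros)
  from this[THEN T_mult_has_derivative[OF assms]]
  show "((\<lambda>y. T y *v (\<qq> + \<ff> y)) has_derivative (\<lambda>X. T x *v dirderiv \<ff> x X)) (at x)"
    "((\<lambda>y. T y *v (\<pp> + \<tt> y)) has_derivative (\<lambda>X. T x *v dirderiv \<tt> x X)) (at x)"
    by (simp_all only: tau_0 scaleR_zero_right add_0_right)
qed

text \<open>Since \<tau> \<pp> = d\<tt> and \<tau> \<tt> = - d\<tt>, a combination \<alpha> \<pp> +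
  \<beta> \<tt> with constant coefficients is parallel for d + \<open>lam\<close> \<tau> when
  \<beta> (1 - lam) = - lam \<alpha>. The same calculation with \<qq> and \<ff> leads to
  \<open>conserved_q\<close>.\<close>

definition conserved_p :: "real^2 \<Rightarrow> real^6"
  where "conserved_p x = (1 - lam) *\<^sub>R \<pp> - lam *\<^sub>R \<tt> x"

definition conserved_q :: "real^2 \<Rightarrow> real^6"
  where "conserved_q x = (1 - lam) *\<^sub>R \<qq> - lam *\<^sub>R \<ff> x"

lemma T_conserved:
  assumes "connected U" "x \<in> U" "y \<in> U"
  shows "T x *v conserved_p x = T y *v conserved_p y" "T x *v conserved_q x = T y *v conserved_q y"
proof -
  have "((\<lambda>y. T y *v conserved_p y) has_derivative (\<lambda>X. 0)) (at z)"
    "((\<lambda>y. T y *v conserved_q y) has_derivative (\<lambda>X. 0)) (at z)" if z: "z \<in> U" for z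
  proof -
    have "(conserved_p has_derivative (\<lambda>X. - lam *\<^sub>R dirderiv \<tt> z X)) (at z)"
      "(conserved_q has_derivative (\<lambda>X. - lam *\<^sub>R dirderiv \<ff> z X)) (at z)"
      unfolding conserved_p_def[abs_def] conserved_q_def[abs_def]
      using deriv[OF z] by (auto intro!: derivative_eq_intros)
    from this[THEN T_mult_has_derivative[OF z]]
    show "((\<lambda>y. T y *v conserved_p y) has_derivative (\<lambda>X. 0)) (at z)"
      "((\<lambda>y. T y *v conserved_q y) has_derivative (\<lambda>X. 0)) (at z)"
      by (simp_all add: tau_mult_vec[OF z] conserved_p_def conserved_q_def ips z)
  qed
  then show "T x *v conserved_p x = T y *v conserved_p y" "T x *v conserved_q x = T y *v conserved_q y"
    using has_derivative_zero_unique_connected[OF open_U assms(1) _ assms(2,3), of "\<lambda>y. T y *v conserved_p y"]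
      has_derivative_zero_unique_connected[OF open_U assms(1) _ assms(2,3), of "\<lambda>y. T y *v conserved_q y"]
    by blast+
qed

end

section \<open>Construction of the deformed flat front\<close>

context gauge
begin

lemma conserved_ip:
  assumes "x \<in> U"
  shows "ip (conserved_p x) (conserved_p x) = 2 * lam - 1" "ip (conserved_q x) (conserved_q x) = 1 - 2 * lam"
    "ip (conserved_p x) (conserved_q x) = 0" "ip (conserved_q x) (conserved_p x) = 0"
    "ip (\<qq> + \<ff> x) (conserved_p x) = 0" "ip (\<qq> + \<ff> x) (conserved_q x) = 1"
    "ip (\<pp> + \<tt> x) (conserved_p x) = -1" "ip (\<pp> + \<tt> x) (conserved_q x) = 0"
  using assms by (simp_all add: conserved_p_def conserved_q_def ips algebra_simps)

text \<open>The cases $\lambda < \frac12$ and $\lambda > \frac12$ are unified by letting \<open>g1\<close> be \<open>\<ff>\<close> in the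
  former and \<open>\<tt>\<close> in the latter: $|T P|^2$ changes sign at $\frac12$, and with it the roles of the
  two spanning sections of the lift.\<close>

lemma deformed_flat_front:
  assumes frame: "adapted_frame \<pp> \<qq> \<ee>" and conn: "connected U" and x0: "x0 \<in> U" and c: "c \<noteq> 0"
    and g: "g1 = \<ff> \<and> n1 = \<qq> \<and> g2 = \<tt> \<and> n2 = \<pp> \<or> g1 = \<tt> \<and> n1 = \<pp> \<and> g2 = \<ff> \<and> n2 = \<qq>"
    and const: "\<And>x. x \<in> U \<Longrightarrow> T x *v P x = T x0 *v P x0" "\<And>x. x \<in> U \<Longrightarrow> T x *v Q x = T x0 *v Q x0"
    and PQ: "\<And>x. x \<in> U \<Longrightarrow> ip (P x) (P x) = -1" "\<And>x. x \<in> U \<Longrightarrow> ip (Q x) (Q x) = 1"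
      "\<And>x. x \<in> U \<Longrightarrow> ip (P x) (Q x) = 0"
    and lift: "\<And>x. x \<in> U \<Longrightarrow> c * ip (n1 + g1 x) (Q x) = 1" "\<And>x. x \<in> U \<Longrightarrow> ip (n1 + g1 x) (P x) = 0"
      "\<And>x. x \<in> U \<Longrightarrow> ip (n2 + g2 x) (Q x) = 0" "\<And>x. x \<in> U \<Longrightarrow> c * ip (n2 + g2 x) (P x) = -1"
    and flat: "\<And>x. x \<in> U \<Longrightarrow> flatness_defect E G \<phi> x = 0"
  shows "\<exists>A\<in>O42. \<exists>\<ff>' \<tt>'. flat_front \<pp> \<qq> \<ee> U \<ff>' \<tt>' \<and>
       (\<forall>x\<in>U. transformed (\<lambda>y. A ** T y) (legendre_lift \<pp> \<qq> \<ff> \<tt>) x = legendre_lift \<pp> \<qq> \<ff>' \<tt>' x)"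
proof -
  have frame': "ip \<pp> \<pp> = -1" "ip \<qq> \<qq> = 1" "ip \<ee> \<ee> = -1" "ip \<pp> \<qq> = 0" "ip \<pp> \<ee> = 0" "ip \<qq> \<ee> = 0"
    using frame by (simp_all add: adapted_frame_def)
  have iso: "ip (n1 + g1 x) (n1 + g1 x) = 0" "ip (n2 + g2 x) (n2 + g2 x) = 0"
    "ip (n2 + g2 x) (n1 + g1 x) = 0" "ip (n2 + g2 x) (dirderiv g1 x X) = 0" if "x \<in> U" for x X
    using g lift_isotropic[OF that] that by (auto simp: ips)
  \<comment> \<open>Up to the motion \<open>A\<close>, this is the new point of hyperbolic space
    over \<open>x0\<close>. Making it the third frame vector and sending it to \<ee> puts that point
    on the sheet y_0 > 0.\<close>
  define w where "w = c *\<^sub>R (T x0 *v (n1 + g1 x0)) - T x0 *v Q x0"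
  have w: "ip w w = -1" "ip (T x0 *v P x0) w = 0" "ip (T x0 *v Q x0) w = 0"
    using lift(1,2)[OF x0] PQ[OF x0] iso(1)[OF x0] ip_commute[of "Q x0" "n1 + g1 x0"]
      ip_commute[of "P x0" "n1 + g1 x0"]
    by (simp_all add: w_def ip.diff_left ip.diff_right ip.scaleR_left ip.scaleR_right
        O42_ip[OF T_in_O42[OF x0]])
  obtain A where A: "A \<in> O42" "A *v (T x0 *v P x0) = \<pp>" "A *v (T x0 *v Q x0) = \<qq>" "A *v w = \<ee>"
    using O42_frame_transitive[of "T x0 *v P x0" \<pp> "T x0 *v Q x0" \<qq> w \<ee>] w frame' PQ[OF x0]
    by (auto simp: O42_ip[OF T_in_O42[OF x0]])
  define M where "M x = A ** T x" for x
  have M: "M x \<in> O42" "M x *v P x = \<pp>" "M x *v Q x = \<qq>" if "x \<in> U" for x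
    using that A(1) by (simp_all add: M_def O42_mult T_in_O42 matrix_vector_mul_assoc[symmetric] const A(2,3))
  have MQ: "ip (M x *v v) \<qq> = ip v (Q x)" and MP: "ip (M x *v v) \<pp> = ip v (P x)" if "x \<in> U" for x v
    using O42_ip[OF M(1)[OF that], of v] M(2,3)[OF that] by metis+
  \<comment> \<open>\<open>M\<close> turns \<open>Q\<close> and \<open>P\<close> into \<qq> and
    \<pp>, so \<open>c\<close> scales the null sections to have exactly the components \<qq> and
    \<pp> in R^{1,1}; what remains lies in R^{3,1} with square lengths -1 and 1.\<close>
  define f t where "f x = c *\<^sub>R (M x *v (n1 + g1 x)) - \<qq>" and "t x = c *\<^sub>R (M x *v (n2 + g2 x)) - \<pp>" for x
  have D: "((\<lambda>y. T y *v (n1 + g1 y)) has_derivative (\<lambda>X. T x *v dirderiv g1 x X)) (at x)"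
    "((\<lambda>y. T y *v (n2 + g2 y)) has_derivative (\<lambda>X. T x *v dirderiv g2 x X)) (at x)" if "x \<in> U" for x
    using g T_lift_has_derivative[OF that] by auto
  have fd: "(f has_derivative (\<lambda>X. c *\<^sub>R (M x *v dirderiv g1 x X))) (at x)"
    and td: "(t has_derivative (\<lambda>X. c *\<^sub>R (M x *v dirderiv g2 x X))) (at x)" if "x \<in> U" for x
    unfolding f_def[abs_def] t_def[abs_def] M_def matrix_vector_mul_assoc[symmetric]
    by (auto intro!: derivative_eq_intros D[OF that]
        bounded_linear.has_derivative[OF matrix_vector_mul_bounded_linear])
  note fd' = dirderiv_eqI[OF fd] and td' = dirderiv_eqI[OF td]
  have "smooth_map U M"
    unfolding M_def[abs_def]
    by (rule bounded_bilinear_smooth_map[OF bounded_bilinear_matrix_mult open_U smooth_map_const T_smooth])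
  moreover have "smooth_map U (\<lambda>x. n1 + g1 x)" "smooth_map U (\<lambda>x. n2 + g2 x)"
    using g smooth_lift by auto
  ultimately have sm: "smooth_map U f" "smooth_map U t"
    unfolding f_def[abs_def] t_def[abs_def]
    by (auto intro!: smooth_map_diff smooth_map_scaleR smooth_map_const open_U
        bounded_bilinear_smooth_map[OF bounded_bilinear_matrix_vector_mult])
  have ip_pM: "ip \<pp> (M x *v v) = ip v (P x)" "ip \<qq> (M x *v v) = ip v (Q x)" if "x \<in> U" for x v
    using MQ[OF that] MP[OF that] ip_commute by metis+
  have fp: "ip (f x) \<pp> = 0" if "x \<in> U" for x
    using that lift by (simp add: f_def ip.diff_left ip.scaleR_left MP ip_commute[of \<qq> \<pp>] frame')
  have "legendre_pair \<pp> \<qq> U f t"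
  proof
    fix x assume x: "x \<in> U"
    show "ip (f x) (f x) = -1" "ip (t x) (t x) = 1" "ip (t x) (f x) = 0"
      using lift[OF x] by (simp_all add: f_def t_def ip.diff_left ip.diff_right ip.scaleR_left
          ip.scaleR_right O42_ip[OF M(1)[OF x]] iso x MP MQ ip_pM frame')
    show "ip (f x) \<pp> = 0" by (rule fp[OF x])
    show "ip (f x) \<qq> = 0" "ip (t x) \<pp> = 0" "ip (t x) \<qq> = 0"
      using lift[OF x] by (simp_all add: f_def t_def ip.diff_left ip.scaleR_left MP MQ x frame')
    \<comment> \<open>In (t, df) the transformed section is orthogonal to df by
      \<open>iso(4)\<close>; the summand - \<pp> is handled by differentiating (f, \<pp>) =
      0.\<close>
    have "ip (c *\<^sub>R (M x *v dirderiv g1 x X)) \<pp> = 0" for X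
      using ip_const_dirderiv[OF open_U sm(1) smooth_map_const x fp, of X]
      by (simp add: fd'[OF x] ip.zero_right)
    then have "c * ip \<pp> (M x *v dirderiv g1 x X) = 0" for X
      by (metis ip_commute ip.scaleR_left real_scaleR_def)
    then show "ip (t x) (dirderiv f x X) = 0" for X
      by (simp add: fd'[OF x] t_def ip.diff_left ip.scaleR_left ip.scaleR_right
          O42_ip[OF M(1)[OF x]] iso(4)[OF x])
  qed (fact frame' open_U sm)+
  then interpret new: legendre_pair \<pp> \<qq> U f t .
  have regular': "X = 0" if x: "x \<in> U" and X: "dirderiv f x X = 0" "dirderiv t x X = 0" for x X
  proof -
    have "dirderiv g1 x X = 0" "dirderiv g2 x X = 0"
      using X c by (simp_all add: fd'[OF x] td'[OF x] O42_mult_eq_0_iff[OF M(1)[OF x]])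
    then show ?thesis
      using regular[OF x] g by auto
  qed
  \<comment> \<open>A vector orthogonal to both \<pp> and \<ee> would be spacelike, so (f, \<ee>)
    has no zero and keeps on the connected set \<open>U\<close> its sign at
    \<open>x0\<close>.\<close>
  have ne: "ip (f x) \<ee> \<noteq> 0" if x: "x \<in> U" for x
  proof
    assume "ip (f x) \<ee> = 0"
    moreover have "f x \<noteq> 0"
      using new.normalized(1)[OF x] by (auto simp: ip.zero_left)
    ultimately have "ip (f x) (f x) > 0"
      using fp[OF x] by (intro orthogonal_to_timelike_plane[OF frame'(1,3,5)])
    then show False
      using new.normalized(1)[OF x] by simp
  qed
  have "f x0 = \<ee>"
    unfolding A(4)[symmetric] f_def w_def M_def
    by (simp add: matrix_vector_mult_diff_distrib matrix_vector_mult_scaleR A(3) matrix_vector_mul_assoc[symmetric])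
  then have neg: "ip (f x0) \<ee> = -1"
    using frame' by simp
  have "continuous_on U (\<lambda>x. ip (f x) \<ee>)"
    by (intro ip.continuous_on smooth_map_continuous_on sm continuous_on_const)
  then have conn': "connected ((\<lambda>x. ip (f x) \<ee>) ` U)"
    using conn by (rule connected_continuous_image)
  have "ip (f x) \<ee> < 0" if x: "x \<in> U" for x
  proof (rule ccontr)
    assume "\<not> ip (f x) \<ee> < 0"
    then have "0 \<in> (\<lambda>x. ip (f x) \<ee>) ` U"
      using neg by (intro connectedD_interval[OF conn' imageI[OF x0] imageI[OF x]]) auto
    then show False using ne by auto
  qed
  then have "front \<pp> \<qq> \<ee> U f t"
    unfolding front_iff[OF frame open_U] using new.legendre_pair_axioms regular' by blast
  moreover have "gauss_curvature (induced_metric (parallel_front r f t)) x = 0"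
    if x: "x \<in> U" and im: "immersed_at (parallel_front r f t) x" for r x
  proof -
    have g': "g1 = \<ff> \<and> g2 = \<tt> \<or> g1 = \<tt> \<and> g2 = \<ff>"
      using g by blast
    note * = gauss_curvature_parallel_front[OF g' differentiableI[OF fd] differentiableI[OF td] fd' td' M(1) c x]
    have "sinh (\<phi> x - r) \<noteq> 0"
      by (rule *(1)[THEN iffD1]) (use im in auto)
    then show ?thesis
      by (intro *(2)[THEN iffD2] flat[OF x])
  qed
  ultimately have "flat_front \<pp> \<qq> \<ee> U f t"
    by (simp add: flat_front_def)
  moreover have "transformed (\<lambda>y. A ** T y) (legendre_lift \<pp> \<qq> \<ff> \<tt>) x = legendre_lift \<pp> \<qq> f t x" for x
  proof -
    have lift_eq: "legendre_lift \<pp> \<qq> \<ff> \<tt> x = span {n1 + g1 x, n2 + g2 x}"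
      using g by (auto simp only: legendre_lift_def insert_commute)
    have "transformed (\<lambda>y. A ** T y) (legendre_lift \<pp> \<qq> \<ff> \<tt>) x
        = span ((*v) (M x) ` {n1 + g1 x, n2 + g2 x})"
      unfolding transformed_def lift_eq M_def
      by (rule linear_span_image[OF matrix_vector_mul_linear, symmetric])
    also have "\<dots> = span ((\<lambda>y. c *\<^sub>R y) ` ((*v) (M x) ` {n1 + g1 x, n2 + g2 x}))"
      using c by (subst span_image_scale) auto
    also have "\<dots> = legendre_lift \<pp> \<qq> f t x"
      by (simp add: legendre_lift_def f_def t_def)
    finally show ?thesis .
  qed
  ultimately show ?thesis
    using A(1) by blast
qed

end

theorem mainTheorem3:
  fixes \<pp> \<qq> \<ee> :: "real^6" and U :: "(real^2) set"
    and \<ff> \<tt> :: "real^2 \<Rightarrow> real^6" and \<phi> :: "real^2 \<Rightarrow> real"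
  assumes "adapted_frame \<pp> \<qq> \<ee>"
    and "open U" and "simply_connected U"
    and "flat_front \<pp> \<qq> \<ee> U \<ff> \<tt>"
    and "curvature_line_coordinates U \<ff> \<tt> \<phi>"
  shows "\<forall>lam T. lam \<noteq> 1/2 \<longrightarrow> gauge_solution \<pp> \<qq> U \<ff> \<tt> \<phi> lam T \<longrightarrow>
    (\<exists>A\<in>O42. \<exists>\<ff>' \<tt>'. flat_front \<pp> \<qq> \<ee> U \<ff>' \<tt>' \<and>
       (\<forall>x\<in>U. transformed (\<lambda>y. A ** T y) (legendre_lift \<pp> \<qq> \<ff> \<tt>) x = legendre_lift \<pp> \<qq> \<ff>' \<tt>' x))"
proof (intro allI impI)
  fix lam :: real and T :: "real^2 \<Rightarrow> real^6^6"
  assume lam: "lam \<noteq> 1/2" and T: "gauge_solution \<pp> \<qq> U \<ff> \<tt> \<phi> lam T"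
  have pair: "legendre_pair \<pp> \<qq> U \<ff> \<tt>"
    and reg: "\<And>x X. x \<in> U \<Longrightarrow> dirderiv \<ff> x X = 0 \<Longrightarrow> dirderiv \<tt> x X = 0 \<Longrightarrow> X = 0"
    using assms(4) front_iff[OF assms(1,2)] unfolding flat_front_def by blast+
  interpret legendre_pair \<pp> \<qq> U \<ff> \<tt> by (rule pair)
  interpret gauge \<pp> \<qq> U \<ff> \<tt> \<phi> lam T
    using assms(5) reg T unfolding curvature_line_coordinates_def by unfold_locales blast+
  have conn: "connected U"
    using assms(3) by (rule simply_connected_imp_connected)
  have flat: "flatness_defect E G \<phi> x = 0" if x: "x \<in> U" for x
  proof -
    \<comment> \<open>The parameter r = \<phi> x - 1 selects, separately for each \<open>x\<close>,
      a parallel front that immerses there, as sinh 1 is nonzero.\<close>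
    have nz: "sinh (\<phi> x - (\<phi> x - 1)) \<noteq> 0" by simp
    \<comment> \<open>The given front is the case of factor 1 and identity transformation in
      \<open>gauss_curvature_parallel_front\<close>.\<close>
    have id: "dirderiv \<ff> y X = 1 *\<^sub>R (mat 1 *v dirderiv \<ff> y X)"
      "dirderiv \<tt> y X = 1 *\<^sub>R (mat 1 *v dirderiv \<tt> y X)" for y X
      by simp_all
    have one: "mat 1 \<in> O42" by (simp add: O42_def)
    have gg: "\<ff> = \<ff> \<and> \<tt> = \<tt> \<or> \<ff> = \<tt> \<and> \<tt> = \<ff>" by simp
    have diff: "\<ff> differentiable (at y)" "\<tt> differentiable (at y)" if "y \<in> U" for y
      using that smooth by (auto intro: smooth_map_differentiable)
    note * = gauss_curvature_parallel_front[where M = "\<lambda>_. mat 1" and r = "\<phi> x - 1",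
        OF gg diff id one one_neq_zero x]
    have "immersed_at (parallel_front (\<phi> x - 1) \<ff> \<tt>) x"
      by (rule *(1)[THEN iffD2]) (use nz in auto)
    then have "gauss_curvature (induced_metric (parallel_front (\<phi> x - 1) \<ff> \<tt>)) x = 0"
      using assms(4) x unfolding flat_front_def by blast
    then show ?thesis
      by (intro *(2)[THEN iffD1] nz)
  qed
  show "\<exists>A\<in>O42. \<exists>\<ff>' \<tt>'. flat_front \<pp> \<qq> \<ee> U \<ff>' \<tt>' \<and>
       (\<forall>x\<in>U. transformed (\<lambda>y. A ** T y) (legendre_lift \<pp> \<qq> \<ff> \<tt>) x = legendre_lift \<pp> \<qq> \<ff>' \<tt>' x)"
  proof (cases "U = {}")
    case True
    have "mat 1 \<in> O42" by (simp add: O42_def)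
    then show ?thesis
      using True assms(4) by blast
  next
    case False
    then obtain x0 where x0: "x0 \<in> U" by blast
    \<comment> \<open>Division by \<open>c\<close> normalizes the conserved vectors, whose square
      lengths are \<plusminus>(1 - 2 lam).\<close>
    define c where "c = sqrt \<bar>1 - 2 * lam\<bar>"
    have c: "c \<noteq> 0" and c2: "c * c = \<bar>1 - 2 * lam\<bar>"
      using lam by (auto simp: c_def)
    have const: "T x *v (k *\<^sub>R conserved_p x) = T x0 *v (k *\<^sub>R conserved_p x0)"
      "T x *v (k *\<^sub>R conserved_q x) = T x0 *v (k *\<^sub>R conserved_q x0)" if "x \<in> U" for x k
      unfolding matrix_vector_mult_scaleR T_conserved[OF conn that x0] by (rule refl)+
    show ?thesis
    proof (cases "lam < 1/2")
      case True
      then have "2 * lam - 1 = - (c * c)" "1 - 2 * lam = c * c" using c2 by simp_all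
      note ci = conserved_ip[unfolded this]
      show ?thesis
        by (rule deformed_flat_front[where ?g1.0 = \<ff> and ?n1.0 = \<qq> and ?g2.0 = \<tt> and ?n2.0 = \<pp>,
            OF assms(1) conn x0 c _ const(1)[where k = "1/c"] const(2)[where k = "1/c"]])
          (use c in \<open>simp_all add: flat ip.scaleR_left ip.scaleR_right ip.minus_left ip.minus_right ci\<close>)
    next
      case False
      then have "2 * lam - 1 = c * c" "1 - 2 * lam = - (c * c)" using c2 by simp_all
      note ci = conserved_ip[unfolded this]
      \<comment> \<open>Now \<open>conserved_q\<close> is timelike and supplies \<open>P\<close>,
        while \<open>conserved_p\<close> supplies \<open>Q\<close>. The negative factor is forced by
        (\<pp> + \<tt>, conserved_p) = -1, since the first section must pair with \<open>Q\<close>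
        to the positive value 1/c.\<close>
      show ?thesis
        by (rule deformed_flat_front[where ?g1.0 = \<tt> and ?n1.0 = \<pp> and ?g2.0 = \<ff> and ?n2.0 = \<qq>,
            OF assms(1) conn x0 c _ const(2)[where k = "- 1/c"] const(1)[where k = "- 1/c"]])
          (use c in \<open>simp_all add: flat ip.scaleR_left ip.scaleR_right ip.minus_left ip.minus_right ci\<close>)
    qed
  qed
qed

end
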